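(* The graph isomorphism problem is isomorphism-complete on each of the following three classes: $\mathrm{Free}(2K_2\mathbin{\dot\cup}K_1,K_4)$, $\mathrm{Free}(P_6,P_4\mathbin{\dot\cup}P_2,K_4)$, and $\mathrm{Free}(H(1,0,3,0),K_4)$.
   Context: $\mathrm{Free}(H_1,\dots,H_k)$ is the class of graphs containing no $H_i$ as an induced subgraph. $K_t$, $P_t$ denote the complete graph and path on $t$ vertices; $\dot\cup$ is disjoint union and $tH$ the disjoint union of $t$ copies of $H$. For non-negative integers $a_t,\dots,a_1,a_0$ with $a_t>0$, $H(a_t,\dots,a_1,a_0)$ is the disjoint union of an independent set of size $a_0$ with the subdivided star obtained from a center vertex by attaching, for each $i\in\{1,\dots,t\}$, $a_i$ internally disjoint paths of length $i$ (so it has exactly $a_i$ leaves at distance $i$ from the center). Thus $H(1,0,3,0)$ is a center with three pendant leaves and one pendant path of length 3. Isomorphism-complete means polynomial-time equivalent to general graph isomorphism. *)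

theory Defs
  imports "HOL-Library.Nat_Bijection" "HOL-Computational_Algebra.Polynomial"
begin

section \<open>Finite simple graphs\<close>

record 'a ugraph =
  verts :: "'a set"
  edges :: "'a set set"

definition simple_graph :: "'a ugraph \<Rightarrow> bool" where
  "simple_graph G \<longleftrightarrow> finite (verts G) \<and> (\<forall>e\<in>edges G. e \<subseteq> verts G \<and> card e = 2)"

definition isomorphic :: "'a ugraph \<Rightarrow> 'b ugraph \<Rightarrow> bool" (infix \<open>\<simeq>\<close> 50) where
  "G \<simeq> H \<longleftrightarrow> (\<exists>f. bij_betw f (verts G) (verts H) \<and>
     (\<forall>u\<in>verts G. \<forall>v\<in>verts G. {u, v} \<in> edges G \<longleftrightarrow> {f u, f v} \<in> edges H))"

definition induced_subgraph :: "'a ugraph \<Rightarrow> 'a set \<Rightarrow> 'a ugraph" where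
  "induced_subgraph G W = \<lparr>verts = W, edges = {e \<in> edges G. e \<subseteq> W}\<rparr>"

definition contains_induced :: "'a ugraph \<Rightarrow> 'b ugraph \<Rightarrow> bool" where
  "contains_induced G H \<longleftrightarrow> (\<exists>W\<subseteq>verts G. induced_subgraph G W \<simeq> H)"

definition Free :: "'b ugraph set \<Rightarrow> 'a ugraph set" where
  "Free \<H> = {G. simple_graph G \<and> (\<forall>H\<in>\<H>. \<not> contains_induced G H)}"

section \<open>Forbidden subgraphs\<close>

text \<open>All forbidden subgraphs live on natural numbers, so that graphs of different shape
  can be collected in one set; disjointness is achieved by relabelling.\<close>

definition relabel :: "('a \<Rightarrow> 'b) \<Rightarrow> 'a ugraph \<Rightarrow> 'b ugraph" where
  "relabel f G = \<lparr>verts = f ` verts G, edges = (\<lambda>e. f ` e) ` edges G\<rparr>"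

definition disjoint_union :: "nat ugraph \<Rightarrow> nat ugraph \<Rightarrow> nat ugraph" (infixr \<open>\<uplus>\<close> 65) where
  "G \<uplus> H =
     (let G' = relabel (\<lambda>v. 2 * v) G; H' = relabel (\<lambda>v. 2 * v + 1) H
      in \<lparr>verts = verts G' \<union> verts H', edges = edges G' \<union> edges H'\<rparr>)"

definition edgeless :: "nat \<Rightarrow> nat ugraph" where
  "edgeless t = \<lparr>verts = {..<t}, edges = {}\<rparr>"

primrec copies :: "nat \<Rightarrow> nat ugraph \<Rightarrow> nat ugraph" where
  "copies 0 H = edgeless 0"
| "copies (Suc t) H = H \<uplus> copies t H"

definition complete_graph :: "nat \<Rightarrow> nat ugraph" where
  "complete_graph t = \<lparr>verts = {..<t}, edges = {{i, j} | i j. i < t \<and> j < t \<and> i \<noteq> j}\<rparr>"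

definition path_graph :: "nat \<Rightarrow> nat ugraph" where
  "path_graph t = \<lparr>verts = {..<t}, edges = {{i, Suc i} | i. Suc i < t}\<rparr>"

text \<open>The vertex at distance \<open>s\<close> from the centre on the \<open>j\<close>-th path of length \<open>i\<close>;
  the centre is \<open>[]\<close>.\<close>

definition leg_vertex :: "nat \<Rightarrow> nat \<Rightarrow> nat \<Rightarrow> nat list" where
  "leg_vertex i j s = (if s = 0 then [] else [i, j, s])"

definition subdivided_star :: "(nat \<Rightarrow> nat) \<Rightarrow> nat \<Rightarrow> nat ugraph" where
  "subdivided_star a t = relabel list_encode
     \<lparr>verts = insert [] {leg_vertex i j s | i j s. 1 \<le> i \<and> i \<le> t \<and> j < a i \<and> s \<le> i},
      edges = {{leg_vertex i j s, leg_vertex i j (Suc s)} | i j s.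
                 1 \<le> i \<and> i \<le> t \<and> j < a i \<and> s < i}\<rparr>"

text \<open>The argument is the list \<open>[a\<^sub>t, \<dots>, a\<^sub>1, a\<^sub>0]\<close>, highest index first.\<close>

definition star_forest :: "nat list \<Rightarrow> nat ugraph" where
  "star_forest as =
     (let a = (\<lambda>i. rev as ! i) in subdivided_star a (length as - 1) \<uplus> edgeless (a 0))"

section \<open>Polynomial-time computable functions\<close>

text \<open>Deterministic multi-tape Turing machines on two-way infinite tapes. The tape alphabet
  consists of the two bits and the blank \<open>None\<close>. The input is on the first tape and the output
  on the last one. The machine halts when the transition function is \<open>None\<close>.\<close>

type_synonym symbol = "bool option"

datatype direction = Go_Left | Stay | Go_Right

type_synonym tape = "(int \<Rightarrow> symbol) \<times> int"
type_synonym config = "nat \<times> tape list"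

record tm =
  num_tapes :: nat
  states :: "nat set"
  start :: nat
  transition :: "nat \<Rightarrow> symbol list \<Rightarrow> (nat \<times> (symbol \<times> direction) list) option"

definition wf_tm :: "tm \<Rightarrow> bool" where
  "wf_tm M \<longleftrightarrow> num_tapes M \<ge> 1 \<and> finite (states M) \<and> start M \<in> states M \<and>
     (\<forall>q\<in>states M. \<forall>ss q' as. length ss = num_tapes M \<and> transition M q ss = Some (q', as) \<longrightarrow>
        q' \<in> states M \<and> length as = num_tapes M)"

fun read_tape :: "tape \<Rightarrow> symbol" where
  "read_tape (c, h) = c h"

fun offset :: "direction \<Rightarrow> int" where
  "offset Go_Left = -1"
| "offset Stay = 0"
| "offset Go_Right = 1"

fun act_tape :: "symbol \<times> direction \<Rightarrow> tape \<Rightarrow> tape" where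
  "act_tape (s, d) (c, h) = (c(h := s), h + offset d)"

fun halted :: "tm \<Rightarrow> config \<Rightarrow> bool" where
  "halted M (q, ts) \<longleftrightarrow> transition M q (map read_tape ts) = None"

fun tm_step :: "tm \<Rightarrow> config \<Rightarrow> config" where
  "tm_step M (q, ts) =
     (case transition M q (map read_tape ts) of
        None \<Rightarrow> (q, ts)
      | Some (q', as) \<Rightarrow> (q', map2 act_tape as ts))"

definition string_on_tape :: "bool list \<Rightarrow> int \<Rightarrow> symbol" where
  "string_on_tape w i = (if 0 \<le> i \<and> i < int (length w) then Some (w ! nat i) else None)"

definition init_config :: "tm \<Rightarrow> bool list \<Rightarrow> config" where
  "init_config M w =
     (start M, (string_on_tape w, 0) # replicate (num_tapes M - 1) (string_on_tape [], 0))"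

definition poly_time :: "(bool list \<Rightarrow> bool list) \<Rightarrow> bool" where
  "poly_time f \<longleftrightarrow> (\<exists>M p. wf_tm M \<and>
     (\<forall>w. \<exists>t \<le> poly (p :: nat poly) (length w).
        let c = (tm_step M ^^ t) (init_config M w)
        in halted M c \<and> fst (last (snd c)) = string_on_tape (f w)))"

section \<open>Isomorphism-completeness\<close>

text \<open>A promise problem is given by its yes-instances and its no-instances.\<close>

type_synonym problem = "bool list set \<times> bool list set"

definition poly_reducible :: "problem \<Rightarrow> problem \<Rightarrow> bool" where
  "poly_reducible A B \<longleftrightarrow>
     (\<exists>f. poly_time f \<and> (\<forall>w\<in>fst A. f w \<in> fst B) \<and> (\<forall>w\<in>snd A. f w \<in> snd B))"

definition poly_equivalent :: "problem \<Rightarrow> problem \<Rightarrow> bool" where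
  "poly_equivalent A B \<longleftrightarrow> poly_reducible A B \<and> poly_reducible B A"

text \<open>A graph with vertex set \<open>{0, \<dots>, n - 1}\<close> is presented by \<open>n\<close> in unary, a delimiter,
  and its adjacency matrix row by row. The code is self-delimiting, so a pair of graphs can be
  presented by concatenation.\<close>

definition encode_graph :: "nat ugraph \<Rightarrow> bool list" where
  "encode_graph G =
     (let n = card (verts G)
      in replicate n True @ [False] @ [{i, j} \<in> edges G. i \<leftarrow> [0..<n], j \<leftarrow> [0..<n]])"

definition GI_instances :: "nat ugraph set \<Rightarrow> (nat ugraph \<times> nat ugraph) set" where
  "GI_instances \<C> = {(G, G'). G \<in> \<C> \<and> G' \<in> \<C> \<and>
     verts G = {..<card (verts G)} \<and> verts G' = {..<card (verts G')}}"

definition GI :: "nat ugraph set \<Rightarrow> problem" where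
  "GI \<C> =
     ({encode_graph G @ encode_graph G' | G G'. (G, G') \<in> GI_instances \<C> \<and> G \<simeq> G'},
      {encode_graph G @ encode_graph G' | G G'. (G, G') \<in> GI_instances \<C> \<and> \<not> G \<simeq> G'})"

definition isomorphism_complete :: "nat ugraph set \<Rightarrow> bool" where
  "isomorphism_complete \<C> \<longleftrightarrow> poly_equivalent (GI \<C>) (GI {G. simple_graph G})"

end

theory Submission
  imports Defs
begin

text \<open>
  Blow up a graph \<open>G\<close> on \<open>n\<close> vertices to a tripartite graph (hence without \<open>K\<^sub>4\<close>): one part consists
  of \<open>3n\<close> copies of each vertex of \<open>G\<close>, the other two parts consist of the ordered pairs of vertices.
  In the first rule, non-adjacency between different parts joins a copy of \<open>u\<close> to the pairs starting
  with \<open>u\<close>, and the two copies of an edge \<open>(u, w)\<close> and \<open>(w, u)\<close> in different parts. The vertices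
  not adjacent to a given vertex then induce a graph without \<open>P\<^sub>4\<close> and \<open>2K\<^sub>2\<close>, which handles the first
  two classes. In the second rule, a copy of \<open>u\<close> is adjacent to the pairs of the second part that start
  with \<open>u\<close> and to the whole third part, and a pair is non-adjacent exactly to itself and, if it is an edge,
  to its reversal in the other pair part; the three leaves of \<open>H(1,0,3,0)\<close> are then too many, since
  every pair has at most two non-neighbours in the other pair part.

  For \<open>n \<ge> 2\<close> the copies of vertices are recognised by their degree, and \<open>G\<close> can be defined inside its
  blow-up, so blowing up preserves and reflects isomorphism. An entry of the adjacency
  matrix of the blow-up depends only on equalities between loop counters and on one bit of the input
  that moves along with the outer loops; hence the matrix is printed by nested loops whose counters
  are head positions.
\<close>

section \<open>Structured programs for Turing machines\<close>

datatype prog =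
    Act "symbol list \<Rightarrow> (symbol \<times> direction) list"
  | Seq prog prog
  | While "symbol list \<Rightarrow> bool" prog

primrec wf_prog :: "nat \<Rightarrow> prog \<Rightarrow> bool" where
  "wf_prog K (Act f) \<longleftrightarrow> (\<forall>ss. length ss = K \<longrightarrow> length (f ss) = K)"
| "wf_prog K (Seq p q) \<longleftrightarrow> wf_prog K p \<and> wf_prog K q"
| "wf_prog K (While b p) \<longleftrightarrow> wf_prog K p"

text \<open>The control state is the list of programs still to be run. Unfolding \<open>Seq\<close>
  or \<open>While\<close> costs a machine step of its own, in which every tape rewrites its scanned
  symbol and stays.\<close>

fun prog_next :: "prog list \<Rightarrow> symbol list \<Rightarrow> (prog list \<times> (symbol \<times> direction) list) option" where
  "prog_next [] ss = None"
| "prog_next (Act f # k) ss = Some (k, f ss)"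
| "prog_next (Seq p q # k) ss = Some (p # q # k, map (\<lambda>s. (s, Stay)) ss)"
| "prog_next (While b p # k) ss =
     Some (if b ss then p # While b p # k else k, map (\<lambda>s. (s, Stay)) ss)"

fun prog_step :: "prog list \<times> tape list \<Rightarrow> prog list \<times> tape list" where
  "prog_step ([], ts) = ([], ts)"
| "prog_step (Act f # k, ts) = (k, map2 act_tape (f (map read_tape ts)) ts)"
| "prog_step (Seq p q # k, ts) = (p # q # k, ts)"
| "prog_step (While b p # k, ts) = (if b (map read_tape ts) then p # While b p # k else k, ts)"

text \<open>
  The states of the compiled machine: the continuations reachable from a program.
\<close>

primrec conts :: "prog \<Rightarrow> prog list \<Rightarrow> prog list set" where
  "conts (Act f) k = {Act f # k}"
| "conts (Seq p q) k = insert (Seq p q # k) (conts p (q # k) \<union> conts q k)"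
| "conts (While b p) k = insert (While b p # k) (conts p (While b p # k))"

lemma finite_conts: "finite (conts p k)"
  by (induction p arbitrary: k) auto

lemma start_in_conts: "p # k \<in> conts p k"
  by (cases p) auto

text \<open>Leaving \<open>p\<close> ends in \<open>k\<close>, which is shorter than every member of
  \<open>conts p k\<close> and hence has to be inserted. A loop body has the loop itself as its
  continuation.\<close>

lemma conts_closed:
  assumes "c \<in> conts p k" "prog_next c ss = Some (c', as)"
  shows "c' \<in> insert k (conts p k)"
  using assms
proof (induction p arbitrary: k)
  case (Seq p q)
  then show ?case using start_in_conts by fastforce
next
  case (While b p)
  then show ?case using start_in_conts by (fastforce split: if_splits)
qed auto

lemma conts_wf:
  assumes "c \<in> conts p k" "prog_next c ss = Some (c', as)" "wf_prog K p" "length ss = K"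
  shows "length as = K"
  using assms by (induction p arbitrary: k) auto

lemma map2_act_tape_Stay: "map2 act_tape (map (\<lambda>s. (s, Stay)) (map read_tape ts)) ts = ts"
proof (induction ts)
  case (Cons t ts)
  then show ?case by (cases t) auto
qed simp

lemma prog_next_step:
  "prog_next c (map read_tape ts) = Some (c', as) \<Longrightarrow> prog_step (c, ts) = (c', map2 act_tape as ts)"
  using map2_act_tape_Stay[of ts]
  by (cases "(c, map read_tape ts)" rule: prog_next.cases) auto

lemma prog_next_None: "prog_next c ss = None \<longleftrightarrow> c = []"
  by (cases "(c, ss)" rule: prog_next.cases) auto

text \<open>\<open>T\<close> is only an upper bound, and the continuation is universally quantified
  so that runs compose inside \<open>Seq\<close> and \<open>While\<close>.\<close>

definition runs :: "prog \<Rightarrow> nat \<Rightarrow> tape list \<Rightarrow> tape list \<Rightarrow> bool" where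
  "runs p T ts ts' \<longleftrightarrow> (\<exists>t\<le>T. \<forall>k. (prog_step ^^ t) (p # k, ts) = (k, ts'))"

theorem poly_time_prog:
  fixes P :: "nat poly"
  assumes K: "K \<ge> 1" and wf: "wf_prog K p"
    and run: "\<And>w. \<exists>ts. runs p (poly P (length w))
        ((string_on_tape w, 0) # replicate (K - 1) (string_on_tape [], 0)) ts \<and>
        fst (last ts) = string_on_tape (f w)"
  shows "poly_time f"
proof -
  define S where "S = insert [] (conts p [])"
  have fin: "finite S" by (simp add: S_def finite_conts)
  \<comment> \<open>States have to be natural numbers, so the finitely many continuations are
    numbered; the empty one becomes the halting state.\<close>
  obtain h :: "prog list \<Rightarrow> nat" where h: "inj_on h S"
    using finite_imp_inj_to_nat_seg[OF fin] by blast
  define M where "M = \<lparr>num_tapes = K, states = h ` S, start = h [p],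
    transition = (\<lambda>q ss. map_option (\<lambda>(c, as). (h c, as)) (prog_next (inv_into S h q) ss))\<rparr>"
  have inv[simp]: "inv_into S h (h c) = c" if "c \<in> S" for c
    using h that by simp
  have closed: "c' \<in> S" if "c \<in> S" "prog_next c ss = Some (c', as)" for c ss c' as
    using that conts_closed[of c p "[]" ss c' as] by (auto simp: S_def)
  have wfM: "wf_tm M"
    unfolding wf_tm_def
  proof (intro conjI ballI allI impI)
    show "num_tapes M \<ge> 1" using K by (simp add: M_def)
    show "finite (states M)" using fin by (simp add: M_def)
    show "start M \<in> states M" using start_in_conts by (simp add: M_def S_def)
  next
    fix q ss q' as
    assume q: "q \<in> states M" and a: "length ss = num_tapes M \<and> transition M q ss = Some (q', as)"
    from q obtain c where c: "c \<in> S" "q = h c" by (auto simp: M_def)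
    with a obtain c' where c': "prog_next c ss = Some (c', as)" "q' = h c'"
      by (auto simp: M_def)
    show "q' \<in> states M" using closed[OF c(1) c'(1)] c' by (simp add: M_def)
    have "c \<in> conts p []" using c c' by (auto simp: S_def)
    then show "length as = num_tapes M"
      using conts_wf[OF _ c'(1) wf] a by (simp add: M_def)
  qed
  \<comment> \<open>Lockstep simulation: the empty continuation is a fixed point of
    \<open>prog_step\<close>, as a halted configuration is of \<open>tm_step\<close>.\<close>
  have step: "tm_step M (h c, ts) = (h (fst (prog_step (c, ts))), snd (prog_step (c, ts))) \<and>
      fst (prog_step (c, ts)) \<in> S" if "c \<in> S" for c ts
  proof (cases "prog_next c (map read_tape ts)")
    case None
    then have "c = []" by (simp add: prog_next_None)
    then show ?thesis using that by (simp add: M_def)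
  next
    case (Some r)
    then obtain c' as where r: "prog_next c (map read_tape ts) = Some (c', as)" by (cases r) auto
    then show ?thesis using prog_next_step[OF r] closed[OF that r] that by (simp add: M_def)
  qed
  have steps: "(tm_step M ^^ t) (h c, ts) = (h (fst ((prog_step ^^ t) (c, ts))), snd ((prog_step ^^ t) (c, ts)))
      \<and> fst ((prog_step ^^ t) (c, ts)) \<in> S" if "c \<in> S" for c ts t
  proof (induction t)
    case 0
    then show ?case using that by simp
  next
    case (Suc t)
    then show ?case using step[of "fst ((prog_step ^^ t) (c, ts))" "snd ((prog_step ^^ t) (c, ts))"]
      by simp
  qed
  have "\<exists>t \<le> poly P (length w). let c = (tm_step M ^^ t) (init_config M w)
        in halted M c \<and> fst (last (snd c)) = string_on_tape (f w)" for w
  proof -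
    let ?ts = "(string_on_tape w, 0) # replicate (K - 1) (string_on_tape [], 0)"
    obtain ts t where t: "t \<le> poly P (length w)" "(prog_step ^^ t) ([p], ?ts) = ([], ts)"
      and l: "fst (last ts) = string_on_tape (f w)"
      using run[of w] unfolding runs_def by blast
    have "[p] \<in> S" using start_in_conts[of p "[]"] by (simp add: S_def)
    from steps[OF this, of t ?ts] t(2)
    have "(tm_step M ^^ t) (init_config M w) = (h [], ts)"
      by (simp add: init_config_def M_def)
    moreover have "halted M (h [], ts)"
      using inv[of "[]"] by (simp add: M_def S_def)
    ultimately show ?thesis using t(1) l by (intro exI[of _ t]) (simp add: Let_def)
  qed
  then show ?thesis unfolding poly_time_def using wfM by blast
qed

section \<open>Composition rules with time bounds\<close>

lemma runs_mono: "runs p T ts ts' \<Longrightarrow> T \<le> T' \<Longrightarrow> runs p T' ts ts'"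
  unfolding runs_def by (meson le_trans)

lemma runs_Act: "ts' = map2 act_tape (f (map read_tape ts)) ts \<Longrightarrow> runs (Act f) 1 ts ts'"
  unfolding runs_def by (intro exI[of _ 1]) simp

lemma runs_Seq:
  assumes "runs p T ts ts'" "runs q T' ts' ts''"
  shows "runs (Seq p q) (T + T' + 1) ts ts''"
proof -
  obtain t t' where t: "t \<le> T" "\<And>k. (prog_step ^^ t) (p # k, ts) = (k, ts')"
    and t': "t' \<le> T'" "\<And>k. (prog_step ^^ t') (q # k, ts') = (k, ts'')"
    using assms unfolding runs_def by blast
  have "(prog_step ^^ Suc (t' + t)) (Seq p q # k, ts) = (k, ts'')" for k
    using t(2) t'(2) by (simp add: funpow_Suc_right funpow_add del: funpow.simps(2))
  with t(1) t'(1) show ?thesis unfolding runs_def by (intro exI[of _ "Suc (t' + t)"]) simp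
qed

lemma runs_While_False:
  "\<not> b (map read_tape ts) \<Longrightarrow> runs (While b p) 1 ts ts"
  unfolding runs_def by (intro exI[of _ 1]) simp

lemma runs_While_True:
  assumes "b (map read_tape ts)" "runs p T ts ts'" "runs (While b p) T' ts' ts''"
  shows "runs (While b p) (T + T' + 1) ts ts''"
proof -
  obtain t t' where t: "t \<le> T" "\<And>k. (prog_step ^^ t) (p # k, ts) = (k, ts')"
    and t': "t' \<le> T'" "\<And>k. (prog_step ^^ t') (While b p # k, ts') = (k, ts'')"
    using assms unfolding runs_def by blast
  have "(prog_step ^^ Suc (t' + t)) (While b p # k, ts) = (k, ts'')" for k
    using t(2) t'(2) assms(1) by (simp add: funpow_Suc_right funpow_add del: funpow.simps(2))
  with t(1) t'(1) show ?thesis unfolding runs_def by (intro exI[of _ "Suc (t' + t)"]) simp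
qed

lemma runs_While:
  assumes body: "\<And>k. k < n \<Longrightarrow> b (map read_tape (S k)) \<and> runs p T (S k) (S (Suc k))"
    and stop: "\<not> b (map read_tape (S n))"
  shows "runs (While b p) (n * (T + 1) + 1) (S 0) (S n)"
proof -
  \<comment> \<open>Induction on the number of rounds still to go, since the loop rule peels off the
    first round.\<close>
  have "j \<le> n \<Longrightarrow> runs (While b p) (j * (T + 1) + 1) (S (n - j)) (S n)" for j
  proof (induction j)
    case 0
    then show ?case using runs_While_False[of b, OF stop] by simp
  next
    case (Suc j)
    then have "n - Suc j < n" "Suc (n - Suc j) = n - j" by auto
    then have "runs (While b p) (T + (j * (T + 1) + 1) + 1) (S (n - Suc j)) (S n)"
      using body[of "n - Suc j"] Suc
      by (intro runs_While_True[where ts' = "S (n - j)"]) simp_all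
    then show ?case by (rule runs_mono) simp
  qed
  from this[of n] show ?thesis by simp
qed

definition seqs :: "prog list \<Rightarrow> prog" where
  "seqs ps = foldr Seq ps (Act (map (\<lambda>s. (s, Stay))))"

lemma runs_seqs:
  assumes "\<And>i. i < length ps \<Longrightarrow> runs (ps ! i) T (S i) (S (Suc i))"
  shows "runs (seqs ps) (length ps * (T + 1) + 1) (S 0) (S (length ps))"
  using assms
proof (induction ps arbitrary: S)
  case Nil
  show ?case unfolding seqs_def
    using runs_Act[where f = "map (\<lambda>s. (s, Stay))", OF map2_act_tape_Stay[symmetric]] by simp
next
  case (Cons p ps)
  have "runs (seqs ps) (length ps * (T + 1) + 1) (S (Suc 0)) (S (Suc (length ps)))"
    using Cons.prems[of "Suc _"] by (intro Cons.IH) auto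
  from runs_Seq[OF Cons.prems[of 0, simplified] this]
  show ?case by (simp add: seqs_def algebra_simps)
qed

text \<open>After the sweep the head is on the blank behind the last mark, so one \<open>bwd\<close>
  precedes the rewinding loop; that loop stops at -1, so one \<open>fwd\<close> follows. With its
  counter back at 0 the loop can be nested.\<close>

definition for_loop :: "(symbol list \<Rightarrow> bool) \<Rightarrow> prog \<Rightarrow> prog \<Rightarrow> prog \<Rightarrow> prog \<Rightarrow> prog" where
  "for_loop b step bwd fwd p =
     Seq (While b (Seq p step)) (Seq bwd (Seq (While b bwd) fwd))"

lemma runs_rewind:
  fixes B :: "int \<Rightarrow> tape list"
  assumes cond: "\<And>j. b (map read_tape (B j)) \<longleftrightarrow> 0 \<le> j \<and> j < int n"
    and bwd: "\<And>j. runs bwd 1 (B j) (B (j - 1))"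
    and fwd: "runs fwd 1 (B (-1)) (B 0)"
  shows "runs (Seq bwd (Seq (While b bwd) fwd)) (2 * n + 5) (B (int n)) (B 0)"
proof -
  have "runs (While b bwd) (n * (1 + 1) + 1) (B (int n - 1 - int 0)) (B (int n - 1 - int n))"
  proof (rule runs_While, intro conjI)
    fix k assume "k < n"
    then show "b (map read_tape (B (int n - 1 - int k)))" by (simp only: cond) simp
    show "runs bwd 1 (B (int n - 1 - int k)) (B (int n - 1 - int (Suc k)))"
      using bwd[of "int n - 1 - int k"] by (simp add: algebra_simps)
  qed (simp only: cond, simp)
  then have "runs (While b bwd) (2 * n + 1) (B (int n - 1)) (B (-1))" by (simp add: mult_2)
  from runs_Seq[OF bwd runs_Seq[OF this fwd]] show ?thesis by (rule runs_mono) simp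
qed

text \<open>\<open>S\<close> describes the sweep and \<open>B\<close> the rewinding, indexed by
  integers because the head passes through -1. The bound uses \<open>L\<close> in place of
  \<open>n\<close>, so that nesting yields a polynomial in the input length.\<close>

lemma runs_for_loop:
  fixes B :: "int \<Rightarrow> tape list"
  assumes body: "\<And>k. k < n \<Longrightarrow> b (map read_tape (S k)) \<and> runs p T (S k) (S' k) \<and> runs step 1 (S' k) (S (Suc k))"
    and cond: "\<And>j. b (map read_tape (B j)) \<longleftrightarrow> 0 \<le> j \<and> j < int n"
    and bwd: "\<And>j. runs bwd 1 (B j) (B (j - 1))"
    and fwd: "runs fwd 1 (B (-1)) (B 0)"
    and fin: "S n = B (int n)" and "n \<le> L" and "ts = S 0" and "ts' = B 0"
  shows "runs (for_loop b step bwd fwd p) ((T + 7) * (L + 1)) ts ts'"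
proof -
  have "runs (While b (Seq p step)) (n * ((T + 1 + 1) + 1) + 1) (S 0) (S n)"
  proof (rule runs_While, intro conjI)
    fix k assume "k < n"
    note k = body[OF this]
    then show "b (map read_tape (S k))" by blast
    show "runs (Seq p step) (T + 1 + 1) (S k) (S (Suc k))"
      using k by (blast intro: runs_Seq)
  qed (simp add: fin cond)
  from runs_Seq[OF this, unfolded fin, OF runs_rewind[where B = B, OF cond bwd fwd]]
  have "runs (for_loop b step bwd fwd p) (n * (T + 5) + 7) (S 0) (B 0)"
    unfolding for_loop_def by (rule runs_mono) (simp add: algebra_simps)
  moreover have "n * (T + 5) + 7 \<le> (T + 7) * (L + 1)"
  proof -
    have "n * (T + 5) \<le> L * (T + 7)" using \<open>n \<le> L\<close> by (intro mult_mono) auto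
    then show ?thesis by (simp add: algebra_simps)
  qed
  ultimately show ?thesis using assms by (auto intro: runs_mono)
qed

section \<open>The transformation as a Turing machine\<close>

abbreviation ones :: "nat \<Rightarrow> int \<Rightarrow> symbol" where
  "ones n \<equiv> string_on_tape (replicate n True)"

text \<open>
  The tapes are the input with head at \<open>p\<close>, four loop tapes carrying \<open>n\<close> marks, whose heads are the
  counters \<open>a\<close>, \<open>b\<close>, \<open>a'\<close>, \<open>b'\<close>, four tapes with a single mark at 0, and the output. A tape of the third
  kind has its head at the difference of two counters and so reads the mark iff they are equal.
\<close>

definition conf :: "(int \<Rightarrow> symbol) \<Rightarrow> nat \<Rightarrow> int \<Rightarrow> int \<Rightarrow> int \<Rightarrow> int \<Rightarrow> int \<Rightarrow> bool list \<Rightarrow> tape list" where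
  "conf c n p a b a' b' out =
     [(c, p), (ones n, a), (ones n, b), (ones n, a'), (ones n, b'),
      (ones 1, a' - a), (ones 1, a' - b), (ones 1, b' - a), (ones 1, b' - b),
      (string_on_tape out, int (length out))]"

lemma ones_eq: "ones n j = Some True \<longleftrightarrow> 0 \<le> j \<and> j < int n"
  by (auto simp: string_on_tape_def)

lemma mark_diff: "string_on_tape [True] (int v - int u) = Some True \<longleftrightarrow> u = v"
  by (auto simp: string_on_tape_def)

lemma string_on_tape_snoc:
  "(string_on_tape xs)(int (length xs) := Some b) = string_on_tape (xs @ [b])"
  by (auto simp: string_on_tape_def fun_eq_iff nth_append nat_less_iff)

lemma string_on_tape_drop: "string_on_tape w (int m + int k) = string_on_tape (drop m w) (int k)"
  by (auto simp: string_on_tape_def nat_add_distrib)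

lemma ones_Suc: "(ones k)(int k := Some True) = ones (Suc k)"
  using string_on_tape_snoc[of "replicate k True" True]
  by (simp add: replicate_append_same flip: replicate_Suc)

lemma ones_erase: "(ones (Suc k))(int k := None) = ones k"
  by (auto simp: string_on_tape_def fun_eq_iff nth_replicate simp del: replicate_Suc)

section \<open>Nested counting loops and output\<close>

abbreviation scan :: "nat \<Rightarrow> symbol list \<Rightarrow> bool" where
  "scan i ss \<equiv> ss ! i = Some True"

definition move :: "direction list \<Rightarrow> prog" where
  "move ds = Act (\<lambda>ss. zip ss ds)"

definition emit :: "(symbol list \<Rightarrow> bool) \<Rightarrow> prog" where
  "emit h = Act (\<lambda>ss. map (\<lambda>s. (s, Stay)) (butlast ss) @ [(Some (h ss), Go_Right)])"

text \<open>Each counter takes its two difference tapes along; \<open>a\<close> and \<open>b\<close>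
  are subtracted there, so in \<open>loop1\<close> and \<open>loop2\<close> those heads move the
  opposite way. Only the forward step of \<open>loop2\<close> moves the input head, and rewinding
  leaves it alone, so it walks through the input matrix row by row.\<close>

definition "loop1 = for_loop (scan 1)
  (move [Stay, Go_Right, Stay, Stay, Stay, Go_Left, Stay, Go_Left, Stay, Stay])
  (move [Stay, Go_Left, Stay, Stay, Stay, Go_Right, Stay, Go_Right, Stay, Stay])
  (move [Stay, Go_Right, Stay, Stay, Stay, Go_Left, Stay, Go_Left, Stay, Stay])"

definition "loop2 = for_loop (scan 2)
  (move [Go_Right, Stay, Go_Right, Stay, Stay, Stay, Go_Left, Stay, Go_Left, Stay])
  (move [Stay, Stay, Go_Left, Stay, Stay, Stay, Go_Right, Stay, Go_Right, Stay])
  (move [Stay, Stay, Go_Right, Stay, Stay, Stay, Go_Left, Stay, Go_Left, Stay])"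

definition "loop3 = for_loop (scan 3)
  (move [Stay, Stay, Stay, Go_Right, Stay, Go_Right, Go_Right, Stay, Stay, Stay])
  (move [Stay, Stay, Stay, Go_Left, Stay, Go_Left, Go_Left, Stay, Stay, Stay])
  (move [Stay, Stay, Stay, Go_Right, Stay, Go_Right, Go_Right, Stay, Stay, Stay])"

definition "loop4 = for_loop (scan 4)
  (move [Stay, Stay, Stay, Stay, Go_Right, Stay, Stay, Go_Right, Go_Right, Stay])
  (move [Stay, Stay, Stay, Stay, Go_Left, Stay, Stay, Go_Left, Go_Left, Stay])
  (move [Stay, Stay, Stay, Stay, Go_Right, Stay, Stay, Go_Right, Go_Right, Stay])"

lemma runs_move:
  "ts' = map2 act_tape (zip (map read_tape ts) ds) ts \<Longrightarrow> 1 \<le> T \<Longrightarrow> runs (move ds) T ts ts'"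
  unfolding move_def by (rule runs_mono[OF runs_Act])

text \<open>\<open>d\<close> is the displacement of the input head by one run of the body; it will
  be \<open>n\<close>, the length of a row of the input matrix.\<close>

lemma runs_loop1:
  assumes "\<And>k. k < n \<Longrightarrow> runs q T (conf c n (p + int k * d) (int k) b a' b' (out @ concat (map h [0..<k])))
      (conf c n (p + int (Suc k) * d) (int k) b a' b' (out @ concat (map h [0..<Suc k])))" "n \<le> L"
  shows "runs (loop1 q) ((T + 7) * (L + 1)) (conf c n p 0 b a' b' out)
           (conf c n (p + int n * d) 0 b a' b' (out @ concat (map h [0..<n])))"
  unfolding loop1_def
  by (rule runs_for_loop[where B = "\<lambda>j. conf c n (p + int n * d) j b a' b' (out @ concat (map h [0..<n]))"
      and S = "\<lambda>k. conf c n (p + int k * d) (int k) b a' b' (out @ concat (map h [0..<k]))"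
      and S' = "\<lambda>k. conf c n (p + int (Suc k) * d) (int k) b a' b' (out @ concat (map h [0..<Suc k]))"])
    (use assms in \<open>auto intro!: runs_move simp: conf_def ones_eq\<close>)

lemma runs_loop2:
  assumes "\<And>k. k < n \<Longrightarrow> runs q T (conf c n (p + int k) a (int k) a' b' (out @ concat (map h [0..<k])))
      (conf c n (p + int k) a (int k) a' b' (out @ concat (map h [0..<Suc k])))" "n \<le> L"
  shows "runs (loop2 q) ((T + 7) * (L + 1)) (conf c n p a 0 a' b' out)
           (conf c n (p + int n) a 0 a' b' (out @ concat (map h [0..<n])))"
  unfolding loop2_def
  by (rule runs_for_loop[where B = "\<lambda>j. conf c n (p + int n) a j a' b' (out @ concat (map h [0..<n]))"
      and S = "\<lambda>k. conf c n (p + int k) a (int k) a' b' (out @ concat (map h [0..<k]))"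
      and S' = "\<lambda>k. conf c n (p + int k) a (int k) a' b' (out @ concat (map h [0..<Suc k]))"])
    (use assms in \<open>auto intro!: runs_move simp: conf_def ones_eq\<close>)

lemma runs_loop3:
  assumes "\<And>k. k < n \<Longrightarrow> runs q T (conf c n p a b (int k) b' (out @ concat (map h [0..<k])))
      (conf c n p a b (int k) b' (out @ concat (map h [0..<Suc k])))" "n \<le> L"
  shows "runs (loop3 q) ((T + 7) * (L + 1)) (conf c n p a b 0 b' out)
           (conf c n p a b 0 b' (out @ concat (map h [0..<n])))"
  unfolding loop3_def
  by (rule runs_for_loop[where B = "\<lambda>j. conf c n p a b j b' (out @ concat (map h [0..<n]))"
      and S = "\<lambda>k. conf c n p a b (int k) b' (out @ concat (map h [0..<k]))"
      and S' = "\<lambda>k. conf c n p a b (int k) b' (out @ concat (map h [0..<Suc k]))"])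
    (use assms in \<open>auto intro!: runs_move simp: conf_def ones_eq\<close>)

lemma runs_loop4:
  assumes "\<And>k. k < n \<Longrightarrow> runs q T (conf c n p a b a' (int k) (out @ concat (map h [0..<k])))
      (conf c n p a b a' (int k) (out @ concat (map h [0..<Suc k])))" "n \<le> L"
  shows "runs (loop4 q) ((T + 7) * (L + 1)) (conf c n p a b a' 0 out)
           (conf c n p a b a' 0 (out @ concat (map h [0..<n])))"
  unfolding loop4_def
  by (rule runs_for_loop[where B = "\<lambda>j. conf c n p a b a' j (out @ concat (map h [0..<n]))"
      and S = "\<lambda>k. conf c n p a b a' (int k) (out @ concat (map h [0..<k]))"
      and S' = "\<lambda>k. conf c n p a b a' (int k) (out @ concat (map h [0..<Suc k]))"])
    (use assms in \<open>auto intro!: runs_move simp: conf_def ones_eq\<close>)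

lemma runs_emit:
  assumes "h (map read_tape (conf c n p a b a' b' out)) = v"
  shows "runs (emit h) 1 (conf c n p a b a' b' out) (conf c n p a b a' b' (out @ [v]))"
  unfolding emit_def using assms
  by (intro runs_Act) (simp add: conf_def string_on_tape_snoc)

lemma runs_emits:
  assumes "\<And>i out. i < m \<Longrightarrow> h i (map read_tape (conf c n p a b a' b' out)) = v i"
  shows "runs (seqs (map (\<lambda>i. emit (h i)) [0..<m])) (m * 2 + 1)
           (conf c n p a b a' b' out) (conf c n p a b a' b' (out @ map v [0..<m]))"
proof -
  have "runs (seqs (map (\<lambda>i. emit (h i)) [0..<m])) (length (map (\<lambda>i. emit (h i)) [0..<m]) * (1 + 1) + 1)
     (conf c n p a b a' b' (out @ map v [0..<0]))
     (conf c n p a b a' b' (out @ map v [0..<length (map (\<lambda>i. emit (h i)) [0..<m])]))"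
  proof (rule runs_seqs)
    fix i assume "i < length (map (\<lambda>i. emit (h i)) [0..<m])"
    then show "runs (map (\<lambda>i. emit (h i)) [0..<m] ! i) 1 (conf c n p a b a' b' (out @ map v [0..<i]))
          (conf c n p a b a' b' (out @ map v [0..<Suc i]))"
      using runs_emit[where h = "h i" and v = "v i" and out = "out @ map v [0..<i]", OF assms] by simp
  qed
  then show ?thesis by (simp add: mult_2_right)
qed

text \<open>
  \<open>g t t' (u = u') (w = u') (u = w') (w = w') x\<close> is the matrix entry in row \<open>(u, w, t)\<close> and column
  \<open>(u', w', t')\<close>, where \<open>x\<close> tells whether \<open>(u, w)\<close> is an edge.
\<close>

type_synonym cell_rule = "nat \<Rightarrow> nat \<Rightarrow> bool \<Rightarrow> bool \<Rightarrow> bool \<Rightarrow> bool \<Rightarrow> bool \<Rightarrow> bool"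

section \<open>Printing the adjacency matrix of a blow-up\<close>

definition cell_read :: "cell_rule \<Rightarrow> nat \<Rightarrow> nat \<Rightarrow> symbol list \<Rightarrow> bool" where
  "cell_read g t t' ss = g t t' (scan 5 ss) (scan 6 ss) (scan 7 ss) (scan 8 ss) (scan 0 ss)"

definition row_prog :: "cell_rule \<Rightarrow> nat \<Rightarrow> prog" where
  "row_prog g t = loop3 (loop4 (seqs (map (\<lambda>t'. emit (cell_read g t t')) [0..<5])))"

text \<open>The outer loops fix the row and the loops of \<open>row_prog\<close> run over the
  columns. The input head moves with the outer loops only, so the bit for \<open>(u, w)\<close>
  stays under it during all five rows of that pair.\<close>

definition matrix_prog :: "cell_rule \<Rightarrow> prog" where
  "matrix_prog g = loop1 (loop2 (seqs (map (row_prog g) [0..<5])))"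

definition cell :: "cell_rule \<Rightarrow> bool \<Rightarrow> nat \<Rightarrow> nat \<Rightarrow> nat \<Rightarrow> nat \<Rightarrow> nat \<Rightarrow> nat \<Rightarrow> bool" where
  "cell g x u w t u' w' t' = g t t' (u = u') (w = u') (u = w') (w = w') x"

definition row :: "cell_rule \<Rightarrow> nat \<Rightarrow> bool \<Rightarrow> nat \<Rightarrow> nat \<Rightarrow> nat \<Rightarrow> bool list" where
  "row g n x u w t =
     concat (map (\<lambda>u'. concat (map (\<lambda>w'. map (cell g x u w t u' w') [0..<5]) [0..<n])) [0..<n])"

definition matrix :: "cell_rule \<Rightarrow> nat \<Rightarrow> (nat \<Rightarrow> bool) \<Rightarrow> bool list" where
  "matrix g n A = concat (map (\<lambda>u. concat (map (\<lambda>w.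
     concat (map (row g n (A (u * n + w)) u w) [0..<5])) [0..<n])) [0..<n])"

lemma runs_row:
  assumes "n \<le> L" "x \<longleftrightarrow> c p = Some True"
  shows "runs (row_prog g t) ((18 * (L + 1) + 7) * (L + 1)) (conf c n p (int u) (int w) 0 0 out)
     (conf c n p (int u) (int w) 0 0 (out @ row g n x u w t))"
  unfolding row_prog_def row_def
proof (rule runs_loop3[OF _ assms(1)])
  fix k assume "k < n"
  let ?h = "\<lambda>w'. map (cell g x u w t k w') [0..<5]"
  let ?out = "out @ concat (map (\<lambda>u'. concat (map (\<lambda>w'. map (cell g x u w t u' w') [0..<5]) [0..<n])) [0..<k])"
  have "runs (loop4 (seqs (map (\<lambda>t'. emit (cell_read g t t')) [0..<5]))) ((11 + 7) * (L + 1))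
     (conf c n p (int u) (int w) (int k) 0 ?out) (conf c n p (int u) (int w) (int k) 0 (?out @ concat (map ?h [0..<n])))"
  proof (rule runs_loop4[OF _ assms(1)])
    fix j assume "j < n"
    \<comment> \<open>Five emissions cost \<open>5 * 2 + 1 = 11\<close> steps, and every loop turns
      a bound \<open>T\<close> into \<open>(T + 7) * (L + 1)\<close>.\<close>
    have "runs (seqs (map (\<lambda>t'. emit (cell_read g t t')) [0..<5])) (5 * 2 + 1)
      (conf c n p (int u) (int w) (int k) (int j) (?out @ concat (map ?h [0..<j])))
      (conf c n p (int u) (int w) (int k) (int j) ((?out @ concat (map ?h [0..<j])) @ map (cell g x u w t k j) [0..<5]))"
      by (rule runs_emits) (simp add: cell_read_def cell_def conf_def mark_diff assms(2))
    then show "runs (seqs (map (\<lambda>t'. emit (cell_read g t t')) [0..<5])) 11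
      (conf c n p (int u) (int w) (int k) (int j) (?out @ concat (map ?h [0..<j])))
      (conf c n p (int u) (int w) (int k) (int j) (?out @ concat (map ?h [0..<Suc j])))"
      by simp
  qed
  then show "runs (loop4 (seqs (map (\<lambda>t'. emit (cell_read g t t')) [0..<5]))) (18 * (L + 1))
     (conf c n p (int u) (int w) (int k) 0 ?out) (conf c n p (int u) (int w) (int k) 0
        (out @ concat (map (\<lambda>u'. concat (map (\<lambda>w'. map (cell g x u w t u' w') [0..<5]) [0..<n])) [0..<Suc k])))"
    by simp
qed

lemma runs_matrix:
  assumes "n \<le> L" "\<And>k. A k \<longleftrightarrow> c (p + int k) = Some True"
  shows "runs (matrix_prog g) ((((5 * ((18 * (L + 1) + 7) * (L + 1) + 1) + 1) + 7) * (L + 1) + 7) * (L + 1))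
     (conf c n p 0 0 0 0 out) (conf c n (p + int n * int n) 0 0 0 0 (out @ matrix g n A))"
  unfolding matrix_prog_def matrix_def
proof (rule runs_loop1[OF _ assms(1)])
  fix u assume "u < n"
  let ?T = "(18 * (L + 1) + 7) * (L + 1)"
  let ?R = "\<lambda>u w. concat (map (row g n (A (u * n + w)) u w) [0..<5])"
  let ?out = "out @ concat (map (\<lambda>u. concat (map (?R u) [0..<n])) [0..<u])"
  let ?p = "p + int u * int n"
  let ?prog = "seqs (map (row_prog g) [0..<5])"
  have "runs (loop2 ?prog) ((5 * (?T + 1) + 1 + 7) * (L + 1)) (conf c n ?p (int u) 0 0 0 ?out)
     (conf c n (?p + int n) (int u) 0 0 0 (?out @ concat (map (?R u) [0..<n])))"
  proof (rule runs_loop2[OF _ assms(1)])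
    fix w assume "w < n"
    let ?r = "row g n (A (u * n + w)) u w"
    let ?o = "?out @ concat (map (?R u) [0..<w])"
    let ?C = "\<lambda>t. conf c n (?p + int w) (int u) (int w) 0 0 (?o @ concat (map ?r [0..<t]))"
    have "runs ?prog (length (map (row_prog g) [0..<5]) * (?T + 1) + 1) (?C 0) (?C (length (map (row_prog g) [0..<5])))"
    proof (rule runs_seqs)
      fix i assume "i < length (map (row_prog g) [0..<5])"
      then have i: "map (row_prog g) [0..<5] ! i = row_prog g i" by simp
      \<comment> \<open>After \<open>u\<close> full rows and \<open>w\<close> further steps the head
        is at the row-major position of the entry \<open>(u, w)\<close>.\<close>
      have "A (u * n + w) \<longleftrightarrow> c (?p + int w) = Some True"
        using assms(2)[of "u * n + w"] by (simp add: algebra_simps)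
      from runs_row[OF assms(1), where c = c and p = "?p + int w", OF this, of g i u w "?o @ concat (map ?r [0..<i])"]
      show "runs (map (row_prog g) [0..<5] ! i) ?T (?C i) (?C (Suc i))"
        unfolding i by simp
    qed
    moreover have "?C (length (map (row_prog g) [0..<5])) = conf c n (?p + int w) (int u) (int w) 0 0
       (?out @ concat (map (?R u) [0..<Suc w]))" by simp
    ultimately show "runs ?prog (5 * (?T + 1) + 1) (conf c n (?p + int w) (int u) (int w) 0 0 ?o)
       (conf c n (?p + int w) (int u) (int w) 0 0 (?out @ concat (map (?R u) [0..<Suc w])))"
      by (simp del: upt_Suc)
  qed
  then show "runs (loop2 ?prog) ((5 * (?T + 1) + 1 + 7) * (L + 1)) (conf c n ?p (int u) 0 0 0 ?out)
     (conf c n (p + int (Suc u) * int n) (int u) 0 0 0 (out @ concat (map (\<lambda>u. concat (map (?R u) [0..<n])) [0..<Suc u])))"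
    by (simp add: algebra_simps)
qed

text \<open>The unary head of the output code: five constant emissions in the two inner loops count
  the \<open>n * (n * 5)\<close> vertices.\<close>

definition unary_prog :: prog where
  "unary_prog = Seq (loop3 (loop4 (seqs (map (\<lambda>_. emit (\<lambda>_. True)) [0..<5])))) (emit (\<lambda>_. False))"

lemma concat_replicate_upt: "concat (map (\<lambda>_. replicate m x) [0..<n]) = replicate (n * m) x"
  by (induction n) (simp_all add: replicate_add[symmetric] add.commute)

lemma runs_unary:
  assumes "n \<le> L"
  shows "runs unary_prog ((18 * (L + 1) + 7) * (L + 1) + 2) (conf c n p a b 0 0 out)
     (conf c n p a b 0 0 (out @ replicate (n * (n * 5)) True @ [False]))"
proof -
  let ?h = "\<lambda>_::nat. replicate (n * 5) True"
  have "runs (loop3 (loop4 (seqs (map (\<lambda>_. emit (\<lambda>_. True)) [0..<5])))) ((18 * (L + 1) + 7) * (L + 1))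
     (conf c n p a b 0 0 out) (conf c n p a b 0 0 (out @ concat (map ?h [0..<n])))"
  proof (rule runs_loop3[OF _ assms])
    fix k assume "k < n"
    let ?out = "out @ concat (map ?h [0..<k])"
    let ?g = "\<lambda>_::nat. replicate 5 True"
    have "runs (loop4 (seqs (map (\<lambda>_. emit (\<lambda>_. True)) [0..<5]))) ((11 + 7) * (L + 1))
     (conf c n p a b (int k) 0 ?out) (conf c n p a b (int k) 0 (?out @ concat (map ?g [0..<n])))"
    proof (rule runs_loop4[OF _ assms])
      fix j assume "j < n"
      have "runs (seqs (map (\<lambda>_. emit (\<lambda>_. True)) [0..<5])) (5 * 2 + 1)
       (conf c n p a b (int k) (int j) (?out @ concat (map ?g [0..<j])))
       (conf c n p a b (int k) (int j) ((?out @ concat (map ?g [0..<j])) @ map (\<lambda>_. True) [0..<5]))"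
        by (rule runs_emits) simp
      then show "runs (seqs (map (\<lambda>_. emit (\<lambda>_. True)) [0..<5])) 11
       (conf c n p a b (int k) (int j) (?out @ concat (map ?g [0..<j])))
       (conf c n p a b (int k) (int j) (?out @ concat (map ?g [0..<Suc j])))"
        by (simp only: upt_Suc_append map_append concat_append) (simp add: map_replicate_const)
    qed
    then show "runs (loop4 (seqs (map (\<lambda>_. emit (\<lambda>_. True)) [0..<5]))) (18 * (L + 1))
     (conf c n p a b (int k) 0 ?out) (conf c n p a b (int k) 0 (out @ concat (map ?h [0..<Suc k])))"
      by (simp add: concat_replicate_upt)
  qed
  from runs_Seq[OF this[unfolded concat_replicate_upt] runs_emit[OF refl]]
  show ?thesis by (simp add: unary_prog_def)
qed

section \<open>Loading and clearing the loop tapes\<close>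

abbreviation move_all :: "direction \<Rightarrow> prog" where
  "move_all d \<equiv> move [Stay, d, d, d, d, Stay, Stay, Stay, Stay, Stay]"

definition write_all :: "symbol \<Rightarrow> direction \<Rightarrow> direction \<Rightarrow> prog" where
  "write_all s d0 d = Act (\<lambda>ss. (ss ! 0, d0) # [(s, d), (s, d), (s, d), (s, d)] @ map (\<lambda>s. (s, Stay)) (drop 5 ss))"

text \<open>The unary prefix of the code becomes the marks of the loop tapes, and the extra move
  skips the delimiter. All four counters move together, so their differences remain 0 and the
  difference tapes can stay.\<close>

definition setup_prog :: prog where
  "setup_prog = Seq (While (scan 0) (write_all (Some True) Go_Right Go_Right))
     (Seq (move (Go_Right # replicate 9 Stay))
       (Seq (move_all Go_Left) (Seq (While (scan 1) (move_all Go_Left)) (move_all Go_Right))))"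

lemma runs_setup:
  assumes "n \<le> L" "\<And>k. k < n \<Longrightarrow> c (p + int k) = Some True" "c (p + int n) \<noteq> Some True"
  shows "runs setup_prog (4 * L + 9) (conf c 0 p 0 0 0 0 out) (conf c n (p + int n + 1) 0 0 0 0 out)"
proof -
  let ?S = "\<lambda>k. conf c k (p + int k) (int k) (int k) (int k) (int k) out"
  have "runs (While (scan 0) (write_all (Some True) Go_Right Go_Right)) (n * (1 + 1) + 1) (?S 0) (?S n)"
  proof (rule runs_While, intro conjI)
    fix k assume "k < n"
    then show "scan 0 (map read_tape (?S k))" by (simp add: conf_def assms)
    show "runs (write_all (Some True) Go_Right Go_Right) 1 (?S k) (?S (Suc k))"
      unfolding write_all_def
      by (intro runs_Act) (simp add: conf_def ones_Suc numeral_eq_Suc)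
  qed (simp add: conf_def assms)
  note 1 = this
  have 2: "runs (move (Go_Right # replicate 9 Stay)) 1 (?S n) (conf c n (p + int n + 1) (int n) (int n) (int n) (int n) out)"
    by (intro runs_move) (simp_all add: conf_def numeral_eq_Suc)
  have 3: "runs (Seq (move_all Go_Left) (Seq (While (scan 1) (move_all Go_Left)) (move_all Go_Right))) (2 * n + 5)
     (conf c n (p + int n + 1) (int n) (int n) (int n) (int n) out) (conf c n (p + int n + 1) 0 0 0 0 out)"
    by (rule runs_rewind[where B = "\<lambda>j. conf c n (p + int n + 1) j j j j out"])
      (auto intro!: runs_move simp: conf_def ones_eq)
  have "runs setup_prog (4 * n + 9) (?S 0) (conf c n (p + int n + 1) 0 0 0 0 out)"
    unfolding setup_prog_def using runs_Seq[OF 1 runs_Seq[OF 2 3]] by (rule runs_mono) simp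
  then show ?thesis using assms(1) by (auto elim: runs_mono)
qed

text \<open>The second graph may have another size, so the marks of the first one must disappear;
  the input head stays where the second code begins.\<close>

definition cleanup_prog :: prog where
  "cleanup_prog = Seq (While (scan 1) (move_all Go_Right)) (Seq (move_all Go_Left)
     (Seq (While (scan 1) (write_all None Stay Go_Left)) (move_all Go_Right)))"

lemma runs_cleanup:
  assumes "n \<le> L"
  shows "runs cleanup_prog (4 * L + 7) (conf c n p 0 0 0 0 out) (conf c 0 p 0 0 0 0 out)"
proof -
  let ?S = "\<lambda>k. conf c n p (int k) (int k) (int k) (int k) out"
  \<comment> \<open>After \<open>k\<close> erasures the heads stand on the last remaining mark, and
    at -1 when none is left.\<close>
  let ?j = "\<lambda>k. int n - int k - 1"
  let ?R = "\<lambda>k. conf c (n - k) p (?j k) (?j k) (?j k) (?j k) out"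
  have "runs (While (scan 1) (move_all Go_Right)) (n * (1 + 1) + 1) (?S 0) (?S n)"
    by (rule runs_While) (auto intro!: runs_move simp: conf_def ones_eq)
  moreover have "runs (move_all Go_Left) 1 (?S n) (?R 0)"
    by (intro runs_move) (simp_all add: conf_def)
  moreover have "runs (While (scan 1) (write_all None Stay Go_Left)) (n * (1 + 1) + 1) (?R 0) (?R n)"
  proof (rule runs_While, intro conjI)
    fix k assume k: "k < n"
    then show "scan 1 (map read_tape (?R k))" by (auto simp add: conf_def ones_eq)
    define m where "m = n - Suc k"
    have m: "n - k = Suc m" "n - Suc k = m" "?j k = int m" "?j (Suc k) = int m - 1"
      using k by (auto simp: m_def)
    show "runs (write_all None Stay Go_Left) 1 (?R k) (?R (Suc k))"
      unfolding write_all_def m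
      by (intro runs_Act) (simp add: conf_def ones_erase numeral_eq_Suc del: replicate_Suc)
  qed (simp add: conf_def string_on_tape_def)
  moreover have "runs (move_all Go_Right) 1 (?R n) (conf c 0 p 0 0 0 0 out)"
    by (intro runs_move) (simp_all add: conf_def)
  ultimately have "runs cleanup_prog (4 * n + 7) (?S 0) (conf c 0 p 0 0 0 0 out)"
    unfolding cleanup_prog_def by (rule runs_mono[OF runs_Seq[OF _ runs_Seq[OF _ runs_Seq]]]) simp_all
  then show ?thesis using assms(1) by (auto elim: runs_mono)
qed


section \<open>The whole transformation and its running time\<close>

definition bit_at :: "bool list \<Rightarrow> nat \<Rightarrow> bool" where
  "bit_at xs k \<longleftrightarrow> k < length xs \<and> xs ! k"

definition prefix_ones :: "bool list \<Rightarrow> nat" where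
  "prefix_ones w = length (takeWhile id w)"

definition block :: "cell_rule \<Rightarrow> bool list \<Rightarrow> bool list" where
  "block g w = (let n = prefix_ones w in
     replicate (n * (n * 5)) True @ [False] @ matrix g n (bit_at (drop (n + 1) w)))"

text \<open>Defined on all strings, since the machine has to halt with this output on malformed
  inputs too. Missing bits count as \<open>False\<close>, as the machine tests for a scanned
  \<open>True\<close>. A code of a graph has \<open>n + 1 + n * n\<close> symbols, after which the
  second block begins.\<close>

definition transform :: "cell_rule \<Rightarrow> bool list \<Rightarrow> bool list" where
  "transform g w = (let n = prefix_ones w in block g w @ block g (drop (n + 1 + n * n) w))"

definition block_prog :: "cell_rule \<Rightarrow> prog" where
  "block_prog g = Seq setup_prog (Seq unary_prog (Seq (matrix_prog g) cleanup_prog))"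

text \<open>The bounds for \<open>matrix_prog\<close>, \<open>unary_prog\<close>,
  \<open>cleanup_prog\<close> and \<open>setup_prog\<close>, and one step for each of the three
  \<open>Seq\<close>.\<close>

definition block_time :: "nat \<Rightarrow> nat" where
  "block_time L = (((5 * ((18 * (L + 1) + 7) * (L + 1) + 1) + 1) + 7) * (L + 1) + 7) * (L + 1)
     + ((18 * (L + 1) + 7) * (L + 1) + 2) + (4 * L + 7) + (4 * L + 9) + 3"

text \<open>The input head never moves left, so only the content from \<open>p\<close> on matters.
  This lets \<open>w\<close> be the rest of the input when the second graph is read.\<close>

lemma runs_block:
  assumes c: "\<And>k. c (p + int k) = string_on_tape w (int k)" and L: "length w \<le> L"
  shows "runs (block_prog g) (block_time L) (conf c 0 p 0 0 0 0 out)
    (conf c 0 (p + int (prefix_ones w + 1 + prefix_ones w * prefix_ones w)) 0 0 0 0 (out @ block g w))"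
proof -
  let ?n = "prefix_ones w"
  let ?p = "p + int ?n + 1"
  have n: "?n \<le> L" using L length_takeWhile_le[of id w] by (simp add: prefix_ones_def)
  have 1: "runs setup_prog (4 * L + 9) (conf c 0 p 0 0 0 0 out) (conf c ?n ?p 0 0 0 0 out)"
  proof (rule runs_setup[OF n])
    show "c (p + int k) = Some True" if "k < ?n" for k
    proof -
      have "k < length w" using that length_takeWhile_le[of id w] by (simp add: prefix_ones_def)
      moreover have "w ! k" using that nth_mem[of k "takeWhile id w"] takeWhile_nth[of k id w]
        by (auto simp: prefix_ones_def dest: set_takeWhileD)
      ultimately show ?thesis by (simp add: c string_on_tape_def)
    qed
    show "c (p + int ?n) \<noteq> Some True"
      using nth_length_takeWhile[of id w] by (auto simp: c string_on_tape_def prefix_ones_def)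
  qed
  note 2 = runs_unary[OF n, where c = c and p = ?p and a = 0 and b = 0 and out = out]
  have "bit_at (drop (?n + 1) w) k \<longleftrightarrow> c (?p + int k) = Some True" for k
    using c[of "?n + 1 + k"] by (auto simp: bit_at_def string_on_tape_def algebra_simps nat_add_distrib)
  note 3 = runs_matrix[where c = c and p = ?p and A = "bit_at (drop (?n + 1) w)", OF n this,
      where g = g and out = "out @ replicate (?n * (?n * 5)) True @ [False]"]
  note 4 = runs_cleanup[OF n, where c = c and p = "?p + int ?n * int ?n" and out = "out @ block g w"]
  have eq: "out @ block g w = (out @ replicate (?n * (?n * 5)) True @ [False]) @ matrix g ?n (bit_at (drop (?n + 1) w))"
    by (simp add: block_def Let_def)
  from runs_Seq[OF 1 runs_Seq[OF 2 runs_Seq[OF 3 4[unfolded eq]]]]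
  have "runs (block_prog g) (block_time L) (conf c 0 p 0 0 0 0 out)
    (conf c 0 (?p + int ?n * int ?n) 0 0 0 0 (out @ block g w))"
    unfolding block_prog_def eq by (rule runs_mono) (simp add: block_time_def)
  then show ?thesis by (simp add: algebra_simps)
qed

text \<open>The initial action writes the single mark on each of the four difference tapes; both
  blocks rely on it.\<close>

definition transform_prog :: "cell_rule \<Rightarrow> prog" where
  "transform_prog g =
     Seq (Act (\<lambda>ss. map (\<lambda>s. (s, Stay)) (take 5 ss) @
        [(Some True, Stay), (Some True, Stay), (Some True, Stay), (Some True, Stay)] @
        map (\<lambda>s. (s, Stay)) (drop 9 ss)))
     (Seq (block_prog g) (block_prog g))"

lemma runs_transform:
  "\<exists>ts. runs (transform_prog g) (2 * block_time (length w) + 3)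
      ((string_on_tape w, 0) # replicate 9 (string_on_tape [], 0)) ts \<and>
    fst (last ts) = string_on_tape (transform g w)"
proof -
  let ?c = "string_on_tape w" and ?n = "prefix_ones w"
  let ?m = "?n + 1 + ?n * ?n"
  let ?w = "drop ?m w"
  let ?f = "(\<lambda>ss. map (\<lambda>s. (s, Stay)) (take 5 ss) @
        [(Some True, Stay), (Some True, Stay), (Some True, Stay), (Some True, Stay)] @
        map (\<lambda>s. (s, Stay)) (drop 9 ss))"
  let ?ts = "(?c, 0) # replicate 9 (string_on_tape [], 0)"
  have mark: "(string_on_tape [])(0 := Some True) = string_on_tape [True]"
    using string_on_tape_snoc[of "[]" True] by simp
  have 0: "runs (Act ?f) 1 ?ts (conf ?c 0 0 0 0 0 0 [])"
    by (intro runs_Act) (simp add: conf_def numeral_eq_Suc mark)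
  have 1: "runs (block_prog g) (block_time (length w)) (conf ?c 0 0 0 0 0 0 [])
      (conf ?c 0 (int ?m) 0 0 0 0 (block g w))"
    using runs_block[of ?c 0 w "length w" g "[]"] by simp
  from runs_block[where c = ?c and p = "int ?m", OF string_on_tape_drop, of "length w" g "block g w"]
  have 2: "runs (block_prog g) (block_time (length w)) (conf ?c 0 (int ?m) 0 0 0 0 (block g w))
      (conf ?c 0 (int ?m + int (prefix_ones ?w + 1 + prefix_ones ?w * prefix_ones ?w)) 0 0 0 0 (transform g w))"
    by (simp add: transform_def Let_def)
  from runs_Seq[OF 0 runs_Seq[OF 1 2]]
  have "runs (transform_prog g) (2 * block_time (length w) + 3) ?ts
    (conf ?c 0 (int ?m + int (prefix_ones ?w + 1 + prefix_ones ?w * prefix_ones ?w)) 0 0 0 0 (transform g w))"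
    unfolding transform_prog_def by (rule runs_mono) simp
  then show ?thesis by (intro exI conjI) (assumption, simp add: conf_def)
qed

lemma wf_seqs: "wf_prog K (seqs ps) \<longleftrightarrow> (\<forall>p\<in>set ps. wf_prog K p)"
  by (induction ps) (auto simp: seqs_def)

lemma wf_emit: "0 < K \<Longrightarrow> wf_prog K (emit h)"
  by (simp add: emit_def)

lemma wf_transform: "wf_prog 10 (transform_prog g)"
  by (simp add: transform_prog_def block_prog_def setup_prog_def unary_prog_def matrix_prog_def
      cleanup_prog_def row_prog_def loop1_def loop2_def loop3_def loop4_def for_loop_def
      wf_seqs wf_emit move_def write_all_def)

theorem poly_time_transform: "poly_time (transform g)"
proof -
  \<comment> \<open>\<open>[:1, 1:]\<close> and \<open>[:0, 1:]\<close> are the polynomials for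
    \<open>L + 1\<close> and \<open>L\<close>, so that \<open>?B\<close> repeats the expression for
    \<open>block_time\<close>.\<close>
  let ?L = "[:1, 1:] :: nat poly"
  let ?B = "(((5 * ((18 * ?L + 7) * ?L + 1) + 1) + 7) * ?L + 7) * ?L
     + ((18 * ?L + 7) * ?L + 2) + (4 * [:0, 1:] + 7) + (4 * [:0, 1:] + 9) + 3"
  have "poly ?L L = L + 1" "poly [:0, 1:] L = L" for L :: nat
    by simp_all
  then have "poly ?B L = block_time L" for L
    by (simp only: block_time_def poly_add poly_mult poly_numeral poly_1)
  then have "poly (2 * ?B + 3) L = 2 * block_time L + 3" for L
    by (simp only: poly_add poly_mult poly_numeral)
  then show ?thesis
    using runs_transform[of g] by (intro poly_time_prog[where K = 10 and P = "2 * ?B + 3", OF _ wf_transform]) simp_all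
qed

section \<open>Blow-ups of graphs and their codes\<close>

text \<open>
  The vertex \<open>(u, w, t)\<close> of a blow-up is the number \<open>5 * (u * n + w) + t\<close>. By truncated subtraction,
  \<open>t = 0, 1, 2\<close> all belong to part 0, the copies of the vertex \<open>u\<close>.
\<close>

definition vu :: "nat \<Rightarrow> nat \<Rightarrow> nat" where "vu n i = i div 5 div n"
definition vw :: "nat \<Rightarrow> nat \<Rightarrow> nat" where "vw n i = i div 5 mod n"
definition part :: "nat \<Rightarrow> nat" where "part i = i mod 5 - 2"

definition adj :: "cell_rule \<Rightarrow> nat \<Rightarrow> (nat \<Rightarrow> nat \<Rightarrow> bool) \<Rightarrow> nat \<Rightarrow> nat \<Rightarrow> bool" where
  "adj g n a i j = cell g (a (vu n i) (vw n i)) (vu n i) (vw n i) (i mod 5) (vu n j) (vw n j) (j mod 5)"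

definition edge_rel :: "nat ugraph \<Rightarrow> nat \<Rightarrow> nat \<Rightarrow> bool" where
  "edge_rel G u w \<longleftrightarrow> {u, w} \<in> edges G"

definition blowup :: "cell_rule \<Rightarrow> nat ugraph \<Rightarrow> nat ugraph" where
  "blowup g G = (let n = card (verts G); N = n * (n * 5) in
     \<lparr>verts = {..<N}, edges = {{i, j} | i j. i < N \<and> j < N \<and> adj g n (edge_rel G) i j}\<rparr>)"

text \<open>\<open>adj\<close> consults \<open>a\<close> only at the coordinates of the row vertex,
  so symmetry is a genuine condition on the rule.\<close>

definition sym_rule :: "cell_rule \<Rightarrow> bool" where
  "sym_rule g \<longleftrightarrow> (\<forall>n a. (\<forall>u w. a u w = a w u) \<longrightarrow>
     (\<forall>i j. adj g n a i j = adj g n a j i) \<and> (\<forall>i. \<not> adj g n a i i))"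

lemma edge_rel_sym: "edge_rel G u w = edge_rel G w u"
  by (simp add: edge_rel_def insert_commute)

lemma edge_rel_irrefl: "simple_graph G \<Longrightarrow> \<not> edge_rel G u u"
  by (auto simp: edge_rel_def simple_graph_def)

lemma sym_ruleD:
  assumes "sym_rule g"
  shows "adj g n (edge_rel G) i j = adj g n (edge_rel G) j i" "\<not> adj g n (edge_rel G) i i"
  using assms edge_rel_sym[of G] unfolding sym_rule_def by blast+

lemma blowup_edge:
  assumes "sym_rule g" "n = card (verts G)" "i < n * (n * 5)" "j < n * (n * 5)"
  shows "{i, j} \<in> edges (blowup g G) \<longleftrightarrow> adj g n (edge_rel G) i j"
  using assms sym_ruleD(1)[OF assms(1), of n G]
  by (auto simp: blowup_def Let_def doubleton_eq_iff)

lemma verts_blowup: "verts (blowup g G) = {..<card (verts G) * (card (verts G) * 5)}"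
  by (simp add: blowup_def Let_def)

lemma simple_blowup:
  assumes "sym_rule g"
  shows "simple_graph (blowup g G)"
  unfolding simple_graph_def
proof (intro conjI ballI)
  fix e assume "e \<in> edges (blowup g G)"
  then obtain i j where e: "e = {i, j}" "i < card (verts G) * (card (verts G) * 5)"
      "j < card (verts G) * (card (verts G) * 5)" "adj g (card (verts G)) (edge_rel G) i j"
    by (auto simp: blowup_def Let_def)
  then have "i \<noteq> j" using sym_ruleD(2)[OF assms] by blast
  then show "e \<subseteq> verts (blowup g G)" "card e = 2" using e by (auto simp: verts_blowup)
qed (simp add: verts_blowup)

section \<open>Codes of graphs and of their blow-ups\<close>

lemma concat_nested_upt:
  "concat (map (\<lambda>u. concat (map (h u) [0..<n])) [0..<m]) =
   concat (map (\<lambda>k. h (k div n) (k mod n)) [0..<m * n])"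
proof (induction m)
  case (Suc m)
  have "map (\<lambda>k. h (k div n) (k mod n)) [m * n..<m * n + n] = map (h m) [0..<n]"
    by (rule nth_equalityI) (auto simp: div_add1_eq)
  then show ?case using Suc
    by (simp add: add.commute[of n] upt_add_eq_append[of 0 "m * n" n])
qed simp

lemma map_conv_concat: "map f xs = concat (map (\<lambda>x. [f x]) xs)"
  by (induction xs) auto

lemma encode_graph_eq:
  "n = card (verts G) \<Longrightarrow> encode_graph G = replicate n True @ [False] @
     map (\<lambda>k. edge_rel G (k div n) (k mod n)) [0..<n * n]"
  unfolding encode_graph_def Let_def edge_rel_def
  using concat_nested_upt[of "\<lambda>i j. [{i, j} \<in> edges G]" n n]
  by (simp add: map_conv_concat[symmetric])

lemma div_5_less: "k < n * (n * 5) \<Longrightarrow> k div 5 < n * n" for k n :: nat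
  by (simp add: less_mult_imp_div_less algebra_simps)

text \<open>Flattening twice turns the column loops over \<open>u'\<close>, \<open>w'\<close>,
  \<open>t'\<close> into one loop over vertex numbers, and flattening twice more does the same for
  the rows.\<close>

lemma matrix_eq:
  assumes "\<And>k. k < n * n \<Longrightarrow> A k = a (k div n) (k mod n)"
  shows "matrix g n A = concat (map (\<lambda>i. map (adj g n a i) [0..<n * (n * 5)]) [0..<n * (n * 5)])"
proof -
  have row: "row g n x u w t = map (\<lambda>j. cell g x u w t (vu n j) (vw n j) (j mod 5)) [0..<n * (n * 5)]" for x u w t
  proof -
    have "row g n x u w t = concat (map (\<lambda>u'. concat (map (\<lambda>w'. concat (map (\<lambda>t'. [cell g x u w t u' w' t']) [0..<5])) [0..<n])) [0..<n])"
      unfolding row_def by (subst map_conv_concat) simp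
    also have "\<dots> = concat (map (\<lambda>k. concat (map (\<lambda>t'. [cell g x u w t (k div n) (k mod n) t']) [0..<5])) [0..<n * n])"
      by (rule concat_nested_upt)
    also have "\<dots> = concat (map (\<lambda>k. [cell g x u w t (k div 5 div n) (k div 5 mod n) (k mod 5)]) [0..<n * n * 5])"
      by (rule concat_nested_upt)
    finally show ?thesis by (simp add: map_conv_concat[symmetric] vu_def vw_def mult.assoc)
  qed
  have "matrix g n A = concat (map (\<lambda>k. concat (map (row g n (A (k div n * n + k mod n)) (k div n) (k mod n)) [0..<5])) [0..<n * n])"
    unfolding matrix_def by (rule concat_nested_upt)
  also have "\<dots> = concat (map (\<lambda>k. row g n (A (k div 5)) (k div 5 div n) (k div 5 mod n) (k mod 5)) [0..<n * n * 5])"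
    by (simp only: div_mult_mod_eq) (rule concat_nested_upt)
  also have "\<dots> = concat (map (\<lambda>i. map (adj g n a i) [0..<n * (n * 5)]) [0..<n * (n * 5)])"
  proof (intro arg_cong[where f = concat] map_cong)
    fix i assume "i \<in> set [0..<n * (n * 5)]"
    then have "A (i div 5) = a (vu n i) (vw n i)"
      by (simp add: assms div_5_less vu_def vw_def)
    then show "row g n (A (i div 5)) (i div 5 div n) (i div 5 mod n) (i mod 5) = map (adj g n a i) [0..<n * (n * 5)]"
      unfolding row by (simp add: adj_def vu_def vw_def)
  qed (simp add: mult.assoc)
  finally show ?thesis .
qed

lemma encode_blowup:
  assumes "sym_rule g" "n = card (verts G)"
  shows "encode_graph (blowup g G) = replicate (n * (n * 5)) True @ [False] @
    concat (map (\<lambda>i. map (adj g n (edge_rel G) i) [0..<n * (n * 5)]) [0..<n * (n * 5)])"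
proof -
  have "map (\<lambda>j. {i, j} \<in> edges (blowup g G)) [0..<n * (n * 5)] = map (adj g n (edge_rel G) i) [0..<n * (n * 5)]"
    if "i < n * (n * 5)" for i
    using that blowup_edge[OF assms] by simp
  then show ?thesis
    by (auto simp: encode_graph_def Let_def verts_blowup assms(2)[symmetric] cong: map_cong
        intro!: arg_cong[where f = concat])
qed

lemma prefix_ones_encode:
  "prefix_ones (encode_graph G @ xs) = card (verts G)"
proof -
  have "takeWhile id (replicate n True @ False # ys) = replicate n True" for n ys
    by (induction n) auto
  then show ?thesis by (simp add: prefix_ones_def encode_graph_def Let_def)
qed

lemma block_encode:
  assumes "sym_rule g"
  shows "block g (encode_graph G @ xs) = encode_graph (blowup g G)"
proof -
  let ?n = "card (verts G)"
  have "bit_at (drop (?n + 1) (encode_graph G @ xs)) k = edge_rel G (k div ?n) (k mod ?n)" if "k < ?n * ?n" for k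
    using that by (simp add: encode_graph_eq[OF refl] bit_at_def nth_append)
  from matrix_eq[where A = "bit_at (drop (?n + 1) (encode_graph G @ xs))", OF this]
  show ?thesis
    unfolding block_def prefix_ones_encode Let_def encode_blowup[OF assms refl] by simp
qed

lemma transform_encode:
  assumes "sym_rule g"
  shows "transform g (encode_graph G @ encode_graph G') = encode_graph (blowup g G) @ encode_graph (blowup g G')"
proof -
  have "drop (card (verts G) + 1 + card (verts G) * card (verts G)) (encode_graph G @ encode_graph G') = encode_graph G'"
    by (simp add: encode_graph_eq[OF refl, of G])
  then show ?thesis
    using block_encode[OF assms, of G "encode_graph G'"] block_encode[OF assms, of G' "[]"]
    by (simp add: transform_def prefix_ones_encode Let_def)
qed

section \<open>The reductions in both directions\<close>

lemma poly_time_id: "poly_time (\<lambda>w. w)"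
proof -
  define M :: tm where "M = \<lparr>num_tapes = 1, states = {0}, start = 0, transition = (\<lambda>_ _. None)\<rparr>"
  have "wf_tm M" by (simp add: wf_tm_def M_def)
  moreover have "halted M (init_config M w)" "fst (last (snd (init_config M w))) = string_on_tape w" for w
    by (simp_all add: M_def init_config_def)
  ultimately show ?thesis
    unfolding poly_time_def Let_def
    by (intro exI[of _ M] exI[of _ 0]) (auto intro!: exI[of _ 0])
qed

text \<open>Instances over the class are instances over all graphs, so one reduction is the
  identity. The other one is \<open>transform\<close>, which on codes of graphs computes the codes
  of the blow-ups.\<close>

theorem isomorphism_complete_blowup:
  assumes g: "sym_rule g" and simple: "\<C> \<subseteq> {G. simple_graph G}"
    and mem: "\<And>G. simple_graph G \<Longrightarrow> blowup g G \<in> \<C>"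
    and iso: "\<And>G G'. (G, G') \<in> GI_instances {G. simple_graph G} \<Longrightarrow> blowup g G \<simeq> blowup g G' \<longleftrightarrow> G \<simeq> G'"
  shows "isomorphism_complete \<C>"
  unfolding isomorphism_complete_def poly_equivalent_def
proof
  have "GI_instances \<C> \<subseteq> GI_instances {G. simple_graph G}"
    using simple by (auto simp: GI_instances_def)
  then show "poly_reducible (GI \<C>) (GI {G. simple_graph G})"
    unfolding poly_reducible_def
    by (intro exI[of _ "\<lambda>w. w"] conjI poly_time_id) (auto simp: GI_def)
  have inst: "(blowup g G, blowup g G') \<in> GI_instances \<C>" if "(G, G') \<in> GI_instances {G. simple_graph G}" for G G'
    using that mem by (auto simp: GI_instances_def verts_blowup)
  show "poly_reducible (GI {G. simple_graph G}) (GI \<C>)"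
    unfolding poly_reducible_def
  proof (intro exI[of _ "transform g"] conjI poly_time_transform ballI)
    fix w assume "w \<in> fst (GI {G. simple_graph G})"
    then obtain G G' where "w = encode_graph G @ encode_graph G'" "(G, G') \<in> GI_instances {G. simple_graph G}" "G \<simeq> G'"
      by (auto simp: GI_def)
    then show "transform g w \<in> fst (GI \<C>)"
      using inst iso unfolding GI_def by (simp add: transform_encode[OF g]) blast
  next
    fix w assume "w \<in> snd (GI {G. simple_graph G})"
    then obtain G G' where "w = encode_graph G @ encode_graph G'" "(G, G') \<in> GI_instances {G. simple_graph G}" "\<not> G \<simeq> G'"
      by (auto simp: GI_def)
    then show "transform g w \<in> snd (GI \<C>)"
      using inst iso unfolding GI_def by (simp add: transform_encode[OF g]) blast
  qed
qed

section \<open>The two blow-up rules\<close>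

text \<open>Wherever the edge bit \<open>a\<close> of the row matters, the column pair is the
  reversed one, which has the same bit because the graph is undirected. This is what makes both
  rules symmetric.\<close>

definition co_rule :: cell_rule where
  "co_rule t t' uu wu uw ww a \<longleftrightarrow> t - 2 \<noteq> t' - 2 \<and>
     (if t - 2 = 0 \<or> t' - 2 = 0 then \<not> uu else \<not> (uw \<and> wu \<and> a))"

definition star_rule :: cell_rule where
  "star_rule t t' uu wu uw ww a \<longleftrightarrow> t - 2 \<noteq> t' - 2 \<and>
     (if t - 2 = 2 \<or> t' - 2 = 2 then t - 2 = 0 \<or> t' - 2 = 0 \<or> \<not> (uu \<and> ww \<or> uw \<and> wu \<and> a) else uu)"

lemma adj_co:
  "adj co_rule n a i j \<longleftrightarrow> part i \<noteq> part j \<and>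
     (if part i = 0 \<or> part j = 0 then vu n i \<noteq> vu n j
      else \<not> (vu n i = vw n j \<and> vw n i = vu n j \<and> a (vu n i) (vw n i)))"
  by (simp add: adj_def cell_def co_rule_def part_def)

lemma adj_star:
  "adj star_rule n a i j \<longleftrightarrow> part i \<noteq> part j \<and>
     (if part i = 2 \<or> part j = 2 then part i = 0 \<or> part j = 0 \<or>
        \<not> (vu n i = vu n j \<and> vw n i = vw n j \<or> vu n i = vw n j \<and> vw n i = vu n j \<and> a (vu n i) (vw n i))
      else vu n i = vu n j)"
  by (simp add: adj_def cell_def star_rule_def part_def)

lemma sym_co: "sym_rule co_rule"
  unfolding sym_rule_def
proof (intro allI impI conjI)
  fix n i j and a :: "nat \<Rightarrow> nat \<Rightarrow> bool" assume "\<forall>u w. a u w = a w u"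
  then have "a u w = a w u" for u w by blast
  then show "adj co_rule n a i j = adj co_rule n a j i" by (auto simp: adj_co)
qed (simp add: adj_co)

lemma sym_star: "sym_rule star_rule"
  unfolding sym_rule_def
proof (intro allI impI conjI)
  fix n i j and a :: "nat \<Rightarrow> nat \<Rightarrow> bool" assume "\<forall>u w. a u w = a w u"
  then have "a u w = a w u" for u w by blast
  then show "adj star_rule n a i j = adj star_rule n a j i" by (auto simp: adj_star)
qed (simp add: adj_star)

section \<open>Excluded patterns in the blow-ups\<close>

lemma part_cases: "part i = 0 \<or> part i = 1 \<or> part i = 2"
proof -
  have "i mod 5 < 5" by simp
  then show ?thesis unfolding part_def by linarith
qed

lemma vertex_eqI:
  assumes "i mod 5 = j mod 5" "vu n i = vu n j" "vw n i = vw n j"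
  shows "i = j"
proof -
  have "i div 5 = j div 5" using assms unfolding vu_def vw_def by (metis div_mult_mod_eq)
  then show ?thesis using assms(1) by (metis div_mult_mod_eq)
qed

text \<open>Parts 1 and 2 consist of the single residues 3 and 4, whereas part 0 comprises three
  residues.\<close>

lemma part_eqD: "part i = part j \<Longrightarrow> part i \<noteq> 0 \<Longrightarrow> i mod 5 = j mod 5"
  unfolding part_def by linarith

lemma adj_parts:
  "g \<in> {co_rule, star_rule} \<Longrightarrow> adj g n a i j \<Longrightarrow> part i \<noteq> part j"
  by (auto simp: adj_co adj_star)

text \<open>
  \<open>2K\<^sub>2 \<union> K\<^sub>1\<close>, \<open>P\<^sub>6\<close> and \<open>P\<^sub>4 \<union> P\<^sub>2\<close> all contain an isolated \<open>h\<close> next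
  to edges \<open>pq\<close>, \<open>rs\<close> between which only \<open>ps\<close> may be adjacent.
\<close>

lemma co_pattern_free:
  fixes a :: "nat \<Rightarrow> nat \<Rightarrow> bool"
  assumes a: "\<And>u. \<not> a u u" "\<And>u w. a u w = a w u"
    and e: "adj co_rule n a p q" "adj co_rule n a r s"
    and ne: "\<not> adj co_rule n a p r" "\<not> adj co_rule n a q r" "\<not> adj co_rule n a q s"
    and h: "\<And>x. x \<in> {p, q, r, s} \<Longrightarrow> \<not> adj co_rule n a h x"
  shows False
proof -
  let ?R = "adj co_rule n a" and ?N = "{p, q, r, s}"
  have deg: "\<exists>y\<in>?N. ?R x y" if "x \<in> ?N" for x
    using that e sym_co a(2) unfolding sym_rule_def by blast
  show False
  proof (cases "part h = 0")
    case True
    have D: "vu n x = vu n h" if "x \<in> ?N" "part x \<noteq> 0" for x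
      using h[OF that(1)] that(2) True by (simp add: adj_co)
    \<comment> \<open>All pairs among the four start with \<open>vu n h\<close>, so non-adjacency of
      two of them across parts would need a loop. Apart from isolated vertices the four thus induce
      a complete multipartite graph, where non-adjacency is transitive.\<close>
    have R: "?R x y \<longleftrightarrow> part x \<noteq> part y \<and> \<not> (part x = 0 \<and> vu n x = vu n h) \<and>
        \<not> (part y = 0 \<and> vu n y = vu n h)" if "x \<in> ?N" "y \<in> ?N" for x y
      using D[OF that(1)] D[OF that(2)] a(1) unfolding adj_co by (auto split: if_splits)
    have "part p = part r" "part r = part q"
      using e ne(1,2) R[of p q] R[of r s] R[of p r] R[of q r] by simp_all
    then show False using e(1) R[of p q] by simp
  next
    case False
    have V: "vu n x = vu n h" if "x \<in> ?N" "part x = 0" for x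
      using h[OF that(1)] that(2) False by (simp add: adj_co)
    have D: "vu n x = vw n h \<and> vw n x = vu n h \<and> a (vu n h) (vw n h)"
      if "x \<in> ?N" "part x \<noteq> 0" "part x \<noteq> part h" for x
      using h[OF that(1)] that(2,3) False by (auto simp: adj_co)
    \<comment> \<open>Such a vertex would have the same neighbours as \<open>h\<close>, hence none
      among the four.\<close>
    have H: "\<not> (vu n x = vu n h \<and> vw n x = vw n h)" if "x \<in> ?N" "part x = part h" for x
    proof
      assume "vu n x = vu n h \<and> vw n x = vw n h"
      with that(2) have "?R x y = ?R h y" for y by (simp add: adj_co)
      then show False using deg[OF that(1)] h by blast
    qed
    \<comment> \<open>The third part contributes only the reversal of \<open>h\<close>, which is
      adjacent to everything outside its part. The remaining non-adjacencies across parts are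
      between copies of \<open>vu n h\<close> and pairs in the part of \<open>h\<close> that start
      with it.\<close>
    have R: "?R x y \<longleftrightarrow> part x \<noteq> part y \<and> \<not> (part x = 0 \<and> part y = part h \<and> vu n y = vu n h) \<and>
        \<not> (part y = 0 \<and> part x = part h \<and> vu n x = vu n h)" (is "_ \<longleftrightarrow> ?rhs") if "x \<in> ?N" "y \<in> ?N" for x y
    proof -
      note facts = V[OF that(1)] V[OF that(2)] D[OF that(1)] D[OF that(2)] H[OF that(1)] H[OF that(2)]
      consider "part x = part y" | "part x = 0" "part y \<noteq> 0" | "part y = 0" "part x \<noteq> 0"
        | "part x \<noteq> 0" "part y \<noteq> 0" "part x \<noteq> part y" "part x = part h"
        | "part x \<noteq> 0" "part y \<noteq> 0" "part x \<noteq> part y" "part y = part h"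
        using part_cases[of x] part_cases[of y] part_cases[of h] False by (elim disjE) simp_all
      then show ?thesis
        by cases (use facts a(1) False in \<open>auto simp: adj_co\<close>)
    qed
    have other: "part x = part y"
      if "part x \<noteq> 0" "part x \<noteq> part h" "part y \<noteq> 0" "part y \<noteq> part h" for x y
      using that False part_cases[of x] part_cases[of y] part_cases[of h] by (elim disjE) simp_all
    note R' = R[of p q] R[of r s] R[of p r] R[of q r] R[of q s]
    \<comment> \<open>An end of \<open>pq\<close> in the third part would force \<open>r\<close>
      into that part too, and then \<open>r\<close> would be adjacent to the other end.\<close>
    have "part p = 0 \<and> part q = part h \<and> vu n q \<noteq> vu n h \<or> part q = 0 \<and> part p = part h \<and> vu n p \<noteq> vu n h"
      using R' e(1) ne(1,2) other[of p q] by (cases "part p = 0"; cases "part q = 0") auto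
    then show False
    proof
      assume *: "part p = 0 \<and> part q = part h \<and> vu n q \<noteq> vu n h"
      \<comment> \<open>Being non-adjacent to \<open>p\<close> and \<open>q\<close>,
        \<open>r\<close> is a pair in the part of \<open>h\<close> starting with
        \<open>vu n h\<close>. Its neighbour \<open>s\<close> then lies in the third part and is
        adjacent to \<open>q\<close>, a contradiction.\<close>
      then have "part r = part h" using R' ne(2) False by simp
      then show False using * R' e(2) ne(3) False by simp
    next
      assume *: "part q = 0 \<and> part p = part h \<and> vu n p \<noteq> vu n h"
      then have "part r = part h" using R' ne(1) False by simp
      then show False using * R' e(2) ne(2,3) False by auto
    qed
  qed
qed

lemma star_nonadj:
  "\<not> adj star_rule n a d x \<Longrightarrow> part d \<noteq> part x \<Longrightarrow> part d \<noteq> 0 \<Longrightarrow> part x \<noteq> 0 \<Longrightarrow>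
     vu n x = vu n d \<and> vw n x = vw n d \<or> vu n x = vw n d \<and> vw n x = vu n d \<and> a (vu n d) (vw n d)"
  using part_cases[of d] part_cases[of x] by (auto simp: adj_star split: if_splits)

text \<open>A non-neighbour of \<open>d\<close> in the other pair part has the coordinates of
  \<open>d\<close> or the reversed ones, which leaves two vertices.\<close>

lemma star_few_nonadj:
  assumes "part x = k" "part y = k" "part z = k" "k \<noteq> 0" "part d \<noteq> 0" "part d \<noteq> k"
    "x \<noteq> y" "x \<noteq> z" "y \<noteq> z"
  shows "adj star_rule n a d x \<or> adj star_rule n a d y \<or> adj star_rule n a d z"
proof (rule ccontr)
  assume "\<not> ?thesis"
  then have nonadj: "\<not> adj star_rule n a d x" "\<not> adj star_rule n a d y" "\<not> adj star_rule n a d z"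
    by auto
  have "x mod 5 = y mod 5" "x mod 5 = z mod 5" using assms by (auto intro!: part_eqD)
  then have "\<not> (vu n x = vu n y \<and> vw n x = vw n y)" "\<not> (vu n x = vu n z \<and> vw n x = vw n z)"
    "\<not> (vu n y = vu n z \<and> vw n y = vw n z)"
    using assms(7-9) vertex_eqI by metis+
  moreover note star_nonadj[OF nonadj(1)] star_nonadj[OF nonadj(2)] star_nonadj[OF nonadj(3)]
  ultimately show False using assms(1-6) by metis
qed

text \<open>If both were missed, one would be the twin of \<open>e\<close> and the other its
  reversal along an edge; a common first coordinate would make that edge a loop.\<close>

lemma star_same_block:
  assumes "part e = 2" "part x = 1" "part y = 1" "x \<noteq> y" "vu n x = vu n y" "\<And>u. \<not> a u u"
  shows "adj star_rule n a e x \<or> adj star_rule n a e y"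
proof -
  have "x mod 5 = y mod 5" using assms part_eqD by auto
  then have "vw n x \<noteq> vw n y"
    using assms vertex_eqI by metis
  then show ?thesis using assms unfolding adj_star by auto
qed

text \<open>\<open>c\<close> is the centre, \<open>x\<close>, \<open>y\<close>, \<open>z\<close> are
  the leaves and \<open>p\<close>, \<open>q\<close>, \<open>r\<close> the long leg. The cases on the
  part of \<open>c\<close> exploit that part 2 is completely joined to part 0, that a pair misses at
  most two vertices of the other pair part, and that copies of one vertex have the same
  neighbours.\<close>

lemma star_pattern_free:
  fixes a :: "nat \<Rightarrow> nat \<Rightarrow> bool"
  assumes a: "\<And>u. \<not> a u u" "\<And>u w. a u w = a w u"
    and R: "R = adj star_rule n a"
    and e: "R c x" "R c y" "R c z" "R c p" "R p q" "R q r"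
    and ne: "\<not> R x y" "\<not> R x z" "\<not> R y z" "\<not> R x p" "\<not> R y p" "\<not> R z p"
      "\<not> R q x" "\<not> R q y" "\<not> R q z" "\<not> R q c" "\<not> R r c" "\<not> R r p" "\<not> R r x" "\<not> R r y" "\<not> R r z"
    and d: "x \<noteq> y" "x \<noteq> z" "y \<noteq> z" "p \<noteq> x" "p \<noteq> y" "p \<noteq> z"
  shows False
proof -
  have sym: "R i j = R j i" for i j unfolding R using sym_star a(2) unfolding sym_rule_def by blast
  have VE: "R i j" if "part i = 0" "part j = 2" for i j using that by (simp add: R adj_star)
  have EV: "R i j" if "part i = 2" "part j = 0" for i j using that by (simp add: R adj_star)
  have VD: "R i j \<longleftrightarrow> vu n i = vu n j" if "part i = 0" "part j = 1" for i j using that by (simp add: R adj_star)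
  have DV: "R i j \<longleftrightarrow> vu n i = vu n j" if "part i = 1" "part j = 0" for i j using that by (simp add: R adj_star)
  have same: "\<not> R i j" if "part i = part j" for i j using that by (simp add: R adj_star)
  have few_E: "\<not> (part d = 1 \<and> part u = 2 \<and> part v = 2 \<and> part w = 2 \<and> u \<noteq> v \<and> u \<noteq> w \<and> v \<noteq> w
      \<and> \<not> R d u \<and> \<not> R d v \<and> \<not> R d w)" for d u v w
    using star_few_nonadj[of u 2 v w d n a] unfolding R by auto
  have few_D: "\<not> (part d = 2 \<and> part u = 1 \<and> part v = 1 \<and> part w = 1 \<and> u \<noteq> v \<and> u \<noteq> w \<and> v \<noteq> w
      \<and> \<not> R d u \<and> \<not> R d v \<and> \<not> R d w)" for d u v w
    using star_few_nonadj[of u 1 v w d n a] unfolding R by auto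
  have blk: "\<not> (part d = 2 \<and> part u = 1 \<and> part v = 1 \<and> u \<noteq> v \<and> vu n u = vu n v
      \<and> \<not> R d u \<and> \<not> R d v)" for d u v
    using star_same_block a(1) unfolding R by blast
  consider "part c = 0" | "part c = 1" | "part c = 2" using part_cases[of c] by metis
  then show False
  proof cases
    case 1
    have nb: "part i = 1 \<and> vu n i = vu n c \<or> part i = 2" if "R c i" for i
      using part_cases[of i] VD[OF 1] same[of c i] 1 that by auto
    consider "part q = 0" | "part q = 1" using part_cases[of q] EV ne(10) 1 by metis
    then show False
    proof cases
      \<comment> \<open>Leaves in part 2 would be adjacent to \<open>q\<close>, so \<open>x\<close>
        and \<open>y\<close> are pairs in the block of \<open>c\<close>. If \<open>p\<close> is in
        part 2, it misses two vertices of one block; otherwise \<open>p\<close> is in this block, so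
        \<open>q\<close> is a copy of the same vertex and adjacent to \<open>x\<close>.\<close>
      assume q: "part q = 0"
      have xy: "part x = 1 \<and> vu n x = vu n c" "part y = 1 \<and> vu n y = vu n c"
        using nb[OF e(1)] nb[OF e(2)] VE[OF q] ne(7,8) by blast+
      show False
      proof (cases "part p = 2")
        case True
        then show False using blk[of p x y] xy ne(4,5) sym d(1) by simp
      next
        case False
        then have "vu n p = vu n c" "part p = 1" using nb[OF e(4)] by auto
        then have "vu n q = vu n c" using e(5) DV[OF _ q] by simp
        then show False using ne(7) VD[OF q] xy(1) by simp
      qed
    next
      assume q: "part q = 1"
      then have p: "part p = 2" using nb[OF e(4)] same[of p q] e(5) by auto
      \<comment> \<open>A leaf in part 1 would force the other two into part 2, because
        \<open>p\<close> misses at most one vertex of a block; it would then miss three vertices of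
        part 2, namely these two and \<open>p\<close>.\<close>
      have E: "part i = 2" if "R c i" "\<not> R i p" "R c j" "R c k" "\<not> R i j" "\<not> R i k" "\<not> R j p" "\<not> R k p"
          "i \<noteq> j" "i \<noteq> k" "j \<noteq> k" "p \<noteq> j" "p \<noteq> k" for i j k
      proof (rule ccontr)
        assume "part i \<noteq> 2"
        then have i: "part i = 1" "vu n i = vu n c" using nb[OF that(1)] by auto
        have "part j = 2" "part k = 2"
          using nb[OF that(3)] nb[OF that(4)] blk[of p i j] blk[of p i k] i p that sym by auto
        then show False using few_E[of i j k p] i p that by blast
      qed
      have "part x = 2" using E[of x y z] e ne d by blast
      moreover have "part y = 2" using E[of y x z] e ne d sym by blast
      moreover have "part z = 2" using E[of z x y] e ne d sym by blast
      ultimately show False using few_E[of q x y z] q ne(7-9) d(1-3) by blast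
    qed
  next
    case 2
    have nb: "part i = 0 \<and> vu n i = vu n c \<or> part i = 2" if "R c i" for i
      using part_cases[of i] DV[OF 2] same[of c i] 2 that by auto
    show False
    proof (cases "part p = 2")
      case True
      \<comment> \<open>All leaves join \<open>p\<close> in part 2, and \<open>q\<close> in part 1
        has to miss all three.\<close>
      then have "part x = 2" "part y = 2" "part z = 2"
        using nb[OF e(1)] nb[OF e(2)] nb[OF e(3)] VE[OF _ True] ne(4-6) by blast+
      moreover have "part q = 1"
        using part_cases[of q] same[of p q] VE[of q x] True e(5) ne(7) calculation by metis
      ultimately show False using few_E[of q x y z] ne(7-9) d(1-3) by simp
    next
      case False
      then have p: "part p = 0" "vu n p = vu n c" using nb[OF e(4)] by auto
      then have x: "part x = 0" "vu n x = vu n c" using nb[OF e(1)] EV[OF _ p(1)] ne(4) by auto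
      \<comment> \<open>\<open>p\<close> and \<open>x\<close> are copies of the same vertex, so
        \<open>q\<close> cannot be adjacent to only one of them.\<close>
      have "part q = 1" using part_cases[of q] same[of p q] EV[of q x] x p e(5) ne(7) by auto
      then show False using VD[OF p(1), of q] DV[of q x] p x e(5) ne(7) by simp
    qed
  next
    case 3
    consider "part q = 1" | "part q = 2" using part_cases[of q] VE[of q c] 3 ne(10) by metis
    then show False
    proof cases
      assume q: "part q = 2"
      have "part i = 1" if "R c i" "\<not> R q i" for i
        using part_cases[of i] same[of c i] EV[OF q] 3 that by auto
      then show False using few_D[of q x y z] q e(1-3) ne(7-9) d(1-3) by blast
    next
      assume q: "part q = 1"
      \<comment> \<open>Here the end \<open>r\<close> decides: it cannot be in part 1 with its
        neighbour \<open>q\<close>, nor in part 0 without an edge to \<open>c\<close>, nor in part 2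
        without an edge to \<open>p\<close>.\<close>
      have p: "part p = 0" using part_cases[of p] same[of p q] same[of c p] q 3 e(4,5) by auto
      show False
        using part_cases[of r] same[of q r] VE[of r c] EV[of r p] p q 3 e(6) ne(11,12) by auto
    qed
  qed
qed

section \<open>Locating the patterns in the forbidden graphs\<close>

lemma contains_inducedE:
  assumes "contains_induced G H"
  obtains f where "inj_on f (verts H)" "\<And>x. x \<in> verts H \<Longrightarrow> f x \<in> verts G"
    "\<And>x y. x \<in> verts H \<Longrightarrow> y \<in> verts H \<Longrightarrow> {f x, f y} \<in> edges G \<longleftrightarrow> {x, y} \<in> edges H"
proof -
  obtain W g where W: "W \<subseteq> verts G" and g: "bij_betw g W (verts H)"
    and e: "\<And>u v. u \<in> W \<Longrightarrow> v \<in> W \<Longrightarrow> {u, v} \<in> edges G \<longleftrightarrow> {g u, g v} \<in> edges H"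
    using assms unfolding contains_induced_def isomorphic_def induced_subgraph_def by auto
  define f where "f = inv_into W g"
  have f: "bij_betw f (verts H) W" unfolding f_def by (rule bij_betw_inv_into[OF g])
  have mem: "f x \<in> W" if "x \<in> verts H" for x using f that by (auto simp: bij_betw_def)
  have gf: "g (f x) = x" if "x \<in> verts H" for x
    unfolding f_def using that g by (meson bij_betw_inv_into_right)
  show ?thesis
    using that[of f] f mem gf W e by (auto simp: bij_betw_def)
qed

lemma relabel_edge_iff:
  assumes "inj f"
  shows "{f a, f b} \<in> edges (relabel f G) \<longleftrightarrow> {a, b} \<in> edges G"
proof -
  have "{f a, f b} = f ` e \<longleftrightarrow> e = {a, b}" for e
    using inj_image_eq_iff[OF assms, of e "{a, b}"] by auto
  then show ?thesis by (simp add: relabel_def image_iff)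
qed

lemma relabel_edge_range: "{x, y} \<in> edges (relabel f G) \<Longrightarrow> x \<in> range f"
  by (auto simp: relabel_def)

lemma disjoint_union_edges:
  shows "{2 * a, 2 * b} \<in> edges (G \<uplus> H) \<longleftrightarrow> {a, b} \<in> edges G"
    and "{Suc (2 * a), Suc (2 * b)} \<in> edges (G \<uplus> H) \<longleftrightarrow> {a, b} \<in> edges H"
    and "{2 * a, Suc (2 * b)} \<notin> edges (G \<uplus> H)"
    and "{Suc (2 * a), 2 * b} \<notin> edges (G \<uplus> H)"
proof -
  have e: "edges (G \<uplus> H) = edges (relabel (\<lambda>v. 2 * v) G) \<union> edges (relabel (\<lambda>v. 2 * v + 1) H)"
    by (simp add: disjoint_union_def Let_def)
  have ev: "even x" if "{x, y} \<in> edges (relabel (\<lambda>v. 2 * v) G)" for x y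
    using relabel_edge_range[OF that] by auto
  have od: "odd x" if "{x, y} \<in> edges (relabel (\<lambda>v. 2 * v + 1) H)" for x y
    using relabel_edge_range[OF that] by auto
  have inj: "inj (\<lambda>v::nat. 2 * v)" "inj (\<lambda>v::nat. 2 * v + 1)" by (auto simp: inj_on_def)
  note rel = relabel_edge_iff[OF inj(1), of a b G] relabel_edge_iff[OF inj(2), of a b H]
  show "{2 * a, 2 * b} \<in> edges (G \<uplus> H) \<longleftrightarrow> {a, b} \<in> edges G"
    using rel(1) od[of "2 * a" "2 * b"] by (auto simp: e)
  show "{Suc (2 * a), Suc (2 * b)} \<in> edges (G \<uplus> H) \<longleftrightarrow> {a, b} \<in> edges H"
    using rel(2) ev[of "Suc (2 * a)" "Suc (2 * b)"] by (auto simp: e)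
  show "{2 * a, Suc (2 * b)} \<notin> edges (G \<uplus> H)"
    using od[of "2 * a" "Suc (2 * b)"] ev[of "Suc (2 * b)" "2 * a"] by (auto simp: e insert_commute)
  show "{Suc (2 * a), 2 * b} \<notin> edges (G \<uplus> H)"
    using ev[of "Suc (2 * a)" "2 * b"] od[of "2 * b" "Suc (2 * a)"] by (auto simp: e insert_commute)
qed

lemma disjoint_union_verts:
  "2 * a \<in> verts (G \<uplus> H) \<longleftrightarrow> a \<in> verts G"
  "Suc (2 * a) \<in> verts (G \<uplus> H) \<longleftrightarrow> a \<in> verts H"
  by (auto simp: disjoint_union_def relabel_def Let_def image_iff; presburger)+

lemma path_edges: "{i, j} \<in> edges (path_graph t) \<longleftrightarrow> (j = Suc i \<and> j < t \<or> i = Suc j \<and> i < t)"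
  by (auto simp: path_graph_def doubleton_eq_iff)

lemma complete_edges: "{i, j} \<in> edges (complete_graph t) \<longleftrightarrow> i < t \<and> j < t \<and> i \<noteq> j"
  by (auto simp: complete_graph_def doubleton_eq_iff)

lemma blowup_containsE:
  assumes g: "sym_rule g" and "contains_induced (blowup g G) H"
  obtains f where "inj_on f (verts H)"
    "\<And>x y. x \<in> verts H \<Longrightarrow> y \<in> verts H \<Longrightarrow>
      adj g (card (verts G)) (edge_rel G) (f x) (f y) \<longleftrightarrow> {x, y} \<in> edges H"
proof -
  from contains_inducedE[OF assms(2)] obtain f where f: "inj_on f (verts H)"
     "\<And>x. x \<in> verts H \<Longrightarrow> f x \<in> verts (blowup g G)"
    "\<And>x y. x \<in> verts H \<Longrightarrow> y \<in> verts H \<Longrightarrow> {f x, f y} \<in> edges (blowup g G) \<longleftrightarrow> {x, y} \<in> edges H"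
    by blast
  have "adj g (card (verts G)) (edge_rel G) (f x) (f y) \<longleftrightarrow> {x, y} \<in> edges H"
    if "x \<in> verts H" "y \<in> verts H" for x y
    using f(3)[OF that] f(2)[OF that(1)] f(2)[OF that(2)] blowup_edge[OF g refl, of "f x" G "f y"]
    by (simp add: verts_blowup)
  with f(1) show ?thesis using that by blast
qed

lemma blowup_K4_free:
  assumes "g \<in> {co_rule, star_rule}" "sym_rule g"
  shows "\<not> contains_induced (blowup g G) (complete_graph 4)"
proof
  assume "contains_induced (blowup g G) (complete_graph 4)"
  then obtain f where "inj_on f (verts (complete_graph 4))" and
    f: "\<And>x y. x \<in> verts (complete_graph 4) \<Longrightarrow> y \<in> verts (complete_graph 4) \<Longrightarrow>
      adj g (card (verts G)) (edge_rel G) (f x) (f y) \<longleftrightarrow> {x, y} \<in> edges (complete_graph 4)"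
    using blowup_containsE[OF assms(2)] by metis
  have V: "verts (complete_graph 4) = {..<4}" by (simp add: complete_graph_def)
  have "part (f x) \<noteq> part (f y)" if "x \<noteq> y" "x < 4" "y < 4" for x y
  proof (rule adj_parts[OF assms(1)])
    show "adj g (card (verts G)) (edge_rel G) (f x) (f y)"
      using f[of x y] that by (simp add: complete_edges V)
  qed
  then have "inj_on (\<lambda>x. part (f x)) {..<4::nat}" by (intro inj_onI) (metis lessThan_iff)
  moreover have "(\<lambda>x. part (f x)) ` {..<4::nat} \<subseteq> {0, 1, 2}"
  proof (rule image_subsetI)
    show "part (f x) \<in> {0, 1, 2}" for x using part_cases[of "f x"] by simp
  qed
  ultimately have "card {..<4::nat} \<le> card {0, 1, 2 :: nat}" by (intro card_inj_on_le) auto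
  then show False by simp
qed

lemma co_free:
  assumes "simple_graph G" "{p, q, r, s, h} \<subseteq> verts H" "{p, q} \<in> edges H" "{r, s} \<in> edges H"
    "{p, r} \<notin> edges H" "{q, r} \<notin> edges H" "{q, s} \<notin> edges H"
    "{h, p} \<notin> edges H" "{h, q} \<notin> edges H" "{h, r} \<notin> edges H" "{h, s} \<notin> edges H"
  shows "\<not> contains_induced (blowup co_rule G) H"
proof
  assume "contains_induced (blowup co_rule G) H"
  then obtain f where "inj_on f (verts H)" and
    f: "\<And>x y. x \<in> verts H \<Longrightarrow> y \<in> verts H \<Longrightarrow>
      adj co_rule (card (verts G)) (edge_rel G) (f x) (f y) \<longleftrightarrow> {x, y} \<in> edges H"
    using blowup_containsE[OF sym_co] by metis
  have h: "\<not> adj co_rule (card (verts G)) (edge_rel G) (f h) x" if "x \<in> {f p, f q, f r, f s}" for x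
    using that assms(2,8-11) by (elim insertE emptyE) (simp_all add: f)
  show False
    by (rule co_pattern_free[where a = "edge_rel G" and n = "card (verts G)" and p = "f p" and q = "f q"
        and r = "f r" and s = "f s" and h = "f h",
        OF edge_rel_irrefl[OF assms(1)] edge_rel_sym])
      (use assms(2-7) in \<open>simp_all only: f insert_subset simp_thms not_False_eq_True\<close>, rule h)
qed

lemma copies_2: "copies 2 H = H \<uplus> H \<uplus> edgeless 0"
  by (simp add: numeral_2_eq_2)

text \<open>The witnesses are left unevaluated to display the nesting of the unions:
  \<open>2 * _\<close> enters the left summand and \<open>Suc (2 * _)\<close> the right one. The
  second \<open>K_2\<close> is a left summand inside a right one.\<close>

lemma co_free_2K2_K1:
  "simple_graph G \<Longrightarrow>
    \<not> contains_induced (blowup co_rule G) (copies 2 (complete_graph 2) \<uplus> complete_graph 1)"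
  by (rule co_free[where p = "2 * (2 * 0)" and q = "2 * (2 * 1)" and r = "2 * Suc (2 * (2 * 0))"
      and s = "2 * Suc (2 * (2 * 1))" and h = "Suc (2 * 0)"])
    (simp_all only: copies_2 disjoint_union_edges disjoint_union_verts complete_edges
      insert_subset empty_subsetI, simp_all add: complete_graph_def)

text \<open>\<open>q\<close>, \<open>p\<close>, \<open>s\<close>, \<open>r\<close> are the first
  four vertices of the path in order, so \<open>ps\<close> is its edge \<open>{1, 2}\<close>; the
  end 5 is adjacent only to 4.\<close>

lemma co_free_P6: "simple_graph G \<Longrightarrow> \<not> contains_induced (blowup co_rule G) (path_graph 6)"
  by (rule co_free[where p = 1 and q = 0 and r = 3 and s = 2 and h = 5])
    (simp_all add: path_edges, simp add: path_graph_def)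

lemma co_free_P4_P2:
  "simple_graph G \<Longrightarrow> \<not> contains_induced (blowup co_rule G) (path_graph 4 \<uplus> path_graph 2)"
  by (rule co_free[where p = "2 * 1" and q = "2 * 0" and r = "2 * 3" and s = "2 * 2" and h = "Suc (2 * 0)"])
    (simp_all only: disjoint_union_edges disjoint_union_verts path_edges insert_subset empty_subsetI,
     simp_all add: path_graph_def)


abbreviation star_edges :: "nat list set set" where
  "star_edges \<equiv> {{leg_vertex i j s, leg_vertex i j (Suc s)} | i j s.
     1 \<le> i \<and> i \<le> 3 \<and> j < rev [1, 0, 3, 0] ! i \<and> s < i}"

lemma star_edge_iff:
  "{x, y} \<in> star_edges \<longleftrightarrow> {x, y} \<in> {{[], [1, 0, 1]}, {[], [1, 1, 1]}, {[], [1, 2, 1]},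
     {[], [3, 0, 1]}, {[3, 0, 1], [3, 0, 2]}, {[3, 0, 2], [3, 0, 3]}}"
proof -
  \<comment> \<open>The reversed list gives three legs of length 1 and one of length 3; a triple
    \<open>(i, j, s)\<close> stands for the edge that leaves distance \<open>s\<close> on leg
    \<open>j\<close> of length \<open>i\<close>.\<close>
  let ?S = "{(1, 0, 0), (1, 1, 0), (1, 2, 0), (3, 0, 0), (3, 0, 1), (3, 0, 2)} :: (nat \<times> nat \<times> nat) set"
  have S: "1 \<le> i \<and> i \<le> 3 \<and> j < rev [1, 0, 3, 0 :: nat] ! i \<and> s < i \<longleftrightarrow> (i, j, s) \<in> ?S" for i j s :: nat
  proof -
    consider "i = 0" | "i = 1" | "i = 2" | "i = 3" | "i > 3" by linarith
    then show ?thesis by cases (auto simp: numeral_eq_Suc less_Suc_eq)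
  qed
  have image: "{h i j s | i j s. (i, j, s) \<in> S} = (\<lambda>(i, j, s). h i j s) ` S"
    for h :: "nat \<Rightarrow> nat \<Rightarrow> nat \<Rightarrow> nat list set" and S
    by force
  have "star_edges = {{leg_vertex i j s, leg_vertex i j (Suc s)} | i j s. (i, j, s) \<in> ?S}"
    by (simp only: S)
  also have "\<dots> = (\<lambda>(i, j, s). {leg_vertex i j s, leg_vertex i j (Suc s)}) ` ?S"
    by (rule image)
  also have "\<dots> = {{[], [1, 0, 1]}, {[], [1, 1, 1]}, {[], [1, 2, 1]},
     {[], [3, 0, 1]}, {[3, 0, 1], [3, 0, 2]}, {[3, 0, 2], [3, 0, 3]}}"
    by (simp add: leg_vertex_def numeral_eq_Suc)
  finally show ?thesis by (simp only:)
qed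

lemma star_forest_eq:
  "star_forest [1, 0, 3, 0] = subdivided_star (\<lambda>i. rev [1, 0, 3, 0] ! i) 3 \<uplus> edgeless 0"
  by (simp add: star_forest_def Let_def numeral_3_eq_3)

lemma star_forest_edges:
  "{2 * list_encode x, 2 * list_encode y} \<in> edges (star_forest [1, 0, 3, 0]) \<longleftrightarrow> {x, y} \<in> star_edges"
proof -
  have "inj list_encode" by (metis injI list_encode_inverse)
  from relabel_edge_iff[OF this, of x y "\<lparr>verts = insert [] {leg_vertex i j s | i j s. 1 \<le> i \<and> i \<le> 3 \<and>
      j < rev [1, 0, 3, 0] ! i \<and> s \<le> i}, edges = star_edges\<rparr>"]
  show ?thesis
    unfolding star_forest_eq disjoint_union_edges subdivided_star_def by (simp only: ugraph.select_convs)
qed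

lemma star_forest_verts:
  "x \<in> {[], [1, 0, 1], [1, 1, 1], [1, 2, 1], [3, 0, 1], [3, 0, 2], [3, 0, 3]} \<Longrightarrow>
     2 * list_encode x \<in> verts (star_forest [1, 0, 3, 0])"
proof -
  assume x: "x \<in> {[], [1, 0, 1], [1, 1, 1], [1, 2, 1], [3, 0, 1], [3, 0, 2], [3, 0, 3]}"
  let ?L = "{leg_vertex i j s | i j s. 1 \<le> i \<and> i \<le> 3 \<and> j < rev [1, 0, 3, 0] ! i \<and> s \<le> i}"
  have leg: "[i, j, s] \<in> insert [] ?L"
    if "1 \<le> i" "i \<le> 3" "j < rev [1, 0, 3, 0] ! i" "s \<le> i" "0 < s" for i j s
  proof -
    have "[i, j, s] = leg_vertex i j s" using that(5) by (simp add: leg_vertex_def)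
    with that(1-4) show ?thesis by blast
  qed
  have V: "[1, 0, 1] \<in> insert [] ?L" "[1, 1, 1] \<in> insert [] ?L" "[1, 2, 1] \<in> insert [] ?L"
    "[3, 0, 1] \<in> insert [] ?L" "[3, 0, 2] \<in> insert [] ?L" "[3, 0, 3] \<in> insert [] ?L"
    by (rule leg; simp add: numeral_eq_Suc)+
  from x have "x \<in> insert [] ?L"
    by (elim insertE emptyE) (simp_all only: insertI1 V)
  from imageI[OF this, of list_encode] show ?thesis
    unfolding star_forest_eq disjoint_union_verts subdivided_star_def relabel_def
    by (simp only: ugraph.select_convs)
qed

lemma star_free:
  assumes G: "simple_graph G"
  shows "\<not> contains_induced (blowup star_rule G) (star_forest [1, 0, 3, 0])"
proof
  let ?H = "star_forest [1, 0, 3, 0]"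
  let ?V = "{[], [1, 0, 1], [1, 1, 1], [1, 2, 1], [3, 0, 1], [3, 0, 2], [3, 0, 3]}"
  assume "contains_induced (blowup star_rule G) ?H"
  then obtain f where inj: "inj_on f (verts ?H)" and
    f: "\<And>x y. x \<in> verts ?H \<Longrightarrow> y \<in> verts ?H \<Longrightarrow>
      adj star_rule (card (verts G)) (edge_rel G) (f x) (f y) \<longleftrightarrow> {x, y} \<in> edges ?H"
    using blowup_containsE[OF sym_star] by metis
  define h where "h x = f (2 * list_encode x)" for x
  have h: "adj star_rule (card (verts G)) (edge_rel G) (h x) (h y) \<longleftrightarrow> {x, y} \<in> star_edges"
    if "x \<in> ?V" "y \<in> ?V" for x y
    unfolding h_def
    using f[OF star_forest_verts[OF that(1)] star_forest_verts[OF that(2)]] star_forest_edges[of x y]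
    by (rule trans)
  have "inj_on h ?V"
  proof (rule inj_onI)
    fix x y assume "x \<in> ?V" "y \<in> ?V" "h x = h y"
    then have "2 * list_encode x = 2 * list_encode y"
      unfolding h_def by (meson inj inj_onD star_forest_verts)
    then show "x = y" by (metis list_encode_inverse mult_left_cancel zero_neq_numeral)
  qed
  then have d: "h x = h y \<longleftrightarrow> x = y" if "x \<in> ?V" "y \<in> ?V" for x y
    using that by (meson inj_on_eq_iff)
  show False
    by (rule star_pattern_free[where a = "edge_rel G" and n = "card (verts G)" and c = "h []"
        and x = "h [1, 0, 1]" and y = "h [1, 1, 1]" and z = "h [1, 2, 1]"
        and p = "h [3, 0, 1]" and q = "h [3, 0, 2]" and r = "h [3, 0, 3]",
        OF edge_rel_irrefl[OF G] edge_rel_sym refl])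
      (simp_all add: h[unfolded star_edge_iff] d doubleton_eq_iff)
qed

section \<open>Isomorphisms of blow-ups\<close>

definition idx :: "nat \<Rightarrow> nat \<Rightarrow> nat \<Rightarrow> nat \<Rightarrow> nat" where
  "idx n t u w = t + 5 * (w + n * u)"

lemma idx_simps:
  assumes "t < 5" "w < n"
  shows "idx n t u w mod 5 = t" "vu n (idx n t u w) = u" "vw n (idx n t u w) = w"
    "part (idx n t u w) = t - 2"
  using assms by (simp_all add: idx_def vu_def vw_def part_def del: distrib_left_numeral)

lemma idx_less: "t < 5 \<Longrightarrow> u < n \<Longrightarrow> w < n \<Longrightarrow> idx n t u w < n * (n * 5)"
proof -
  assume *: "t < 5" "u < n" "w < n"
  then have "n * Suc u \<le> n * n" by (intro mult_le_mono2) simp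
  with * have "w + n * u + 1 \<le> n * n" by simp
  then have "(w + n * u + 1) * 5 \<le> n * n * 5" by (rule mult_le_mono1)
  with * show ?thesis by (simp add: idx_def)
qed

lemma coord_less:
  assumes "i < n * (n * 5)"
  shows "vu n i < n" "vw n i < n"
proof -
  have "i div 5 < n * n" using assms by (rule div_5_less)
  moreover from this have "0 < n" by (cases n) auto
  ultimately show "vu n i < n" "vw n i < n"
    unfolding vu_def vw_def by (simp_all add: less_mult_imp_div_less)
qed

lemma bij_coords:
  "bij_betw (\<lambda>i. (i mod 5, vu n i, vw n i)) {..<n * (n * 5)} ({..<5} \<times> {..<n} \<times> {..<n})"
proof (rule bij_betw_byWitness[where f' = "\<lambda>(t, u, w). idx n t u w"])
  show "\<forall>i\<in>{..<n * (n * 5)}. (\<lambda>(t, u, w). idx n t u w) (i mod 5, vu n i, vw n i) = i"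
  proof
    fix i assume "i \<in> {..<n * (n * 5)}"
    then have "vw n i < n" using coord_less by auto
    then have "idx n (i mod 5) (vu n i) (vw n i) = i"
      using vertex_eqI[of "idx n (i mod 5) (vu n i) (vw n i)" i n] by (simp add: idx_simps)
    then show "(\<lambda>(t, u, w). idx n t u w) (i mod 5, vu n i, vw n i) = i" by simp
  qed
qed (auto simp: idx_simps idx_less coord_less)

lemma card_coords:
  "card {i \<in> {..<n * (n * 5)}. Q (i mod 5) (vu n i) (vw n i)} =
   card {(t, u, w). t < 5 \<and> u < n \<and> w < n \<and> Q t u w}"
proof (rule bij_betw_same_card[where f = "\<lambda>i. (i mod 5, vu n i, vw n i)"])
  have "bij_betw (\<lambda>i. (i mod 5, vu n i, vw n i)) {i \<in> {..<n * (n * 5)}. Q (i mod 5) (vu n i) (vw n i)}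
     ((\<lambda>i. (i mod 5, vu n i, vw n i)) ` {i \<in> {..<n * (n * 5)}. Q (i mod 5) (vu n i) (vw n i)})"
    by (rule bij_betw_subset[OF bij_coords]) auto
  moreover have "(\<lambda>i. (i mod 5, vu n i, vw n i)) ` {i \<in> {..<n * (n * 5)}. Q (i mod 5) (vu n i) (vw n i)} =
    {(t, u, w). t < 5 \<and> u < n \<and> w < n \<and> Q t u w}" (is "?f ` ?A = ?B")
  proof
    show "?f ` ?A \<subseteq> ?B" by (auto simp: coord_less)
    show "?B \<subseteq> ?f ` ?A"
    proof
      fix z assume "z \<in> ?B"
      then obtain t u w where z: "z = (t, u, w)" "t < 5" "u < n" "w < n" "Q t u w" by auto
      then show "z \<in> ?f ` ?A"
        by (intro image_eqI[of _ _ "idx n t u w"]) (simp_all add: idx_simps idx_less)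
    qed
  qed
  ultimately show "bij_betw (\<lambda>i. (i mod 5, vu n i, vw n i)) {i \<in> {..<n * (n * 5)}. Q (i mod 5) (vu n i) (vw n i)}
    {(t, u, w). t < 5 \<and> u < n \<and> w < n \<and> Q t u w}" by simp
qed

text \<open>An isomorphism is applied to both coordinates and the residue is kept; the rule sees
  only equalities of coordinates and edge bits.\<close>

lemma blowup_iso:
  assumes g: "sym_rule g" and verts: "verts G = {..<card (verts G)}" "verts G' = {..<card (verts G')}"
    and iso: "G \<simeq> G'"
  shows "blowup g G \<simeq> blowup g G'"
proof -
  let ?n = "card (verts G)"
  obtain \<sigma> where \<sigma>: "bij_betw \<sigma> (verts G) (verts G')"
    and e: "\<And>u v. u \<in> verts G \<Longrightarrow> v \<in> verts G \<Longrightarrow> {u, v} \<in> edges G \<longleftrightarrow> {\<sigma> u, \<sigma> v} \<in> edges G'"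
    using iso unfolding isomorphic_def by blast
  have n: "card (verts G') = ?n" using bij_betw_same_card[OF \<sigma>] by simp
  have e': "edge_rel G' (\<sigma> u) (\<sigma> v) = edge_rel G u v" if "u < ?n" "v < ?n" for u v
    using e[of u v] verts(1) that by (auto simp: edge_rel_def)
  have \<sigma>_less: "\<sigma> u < ?n" if "u < ?n" for u
    using \<sigma> that verts n by (metis bij_betwE lessThan_iff)
  have \<sigma>_eq: "\<sigma> u = \<sigma> v \<longleftrightarrow> u = v" if "u < ?n" "v < ?n" for u v
    using \<sigma> that verts(1) by (metis bij_betw_def inj_on_eq_iff lessThan_iff)
  let ?N = "?n * (?n * 5)"
  define \<phi> where "\<phi> i = idx ?n (i mod 5) (\<sigma> (vu ?n i)) (\<sigma> (vw ?n i))" for i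
  have \<phi>: "\<phi> i < ?N" "\<phi> i mod 5 = i mod 5" "vu ?n (\<phi> i) = \<sigma> (vu ?n i)" "vw ?n (\<phi> i) = \<sigma> (vw ?n i)"
    if "i < ?N" for i
    using coord_less[OF that] by (simp_all add: \<phi>_def idx_simps idx_less \<sigma>_less)
  have inj: "inj_on \<phi> {..<?N}"
  proof (rule inj_onI)
    fix i j assume ij: "i \<in> {..<?N}" "j \<in> {..<?N}" "\<phi> i = \<phi> j"
    then have "i mod 5 = j mod 5" "\<sigma> (vu ?n i) = \<sigma> (vu ?n j)" "\<sigma> (vw ?n i) = \<sigma> (vw ?n j)"
      using \<phi>[of i] \<phi>[of j] by auto
    then show "i = j" using ij coord_less[of i ?n] coord_less[of j ?n] vertex_eqI[of i j ?n] by (simp add: \<sigma>_eq)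
  qed
  moreover have "\<phi> ` {..<?N} \<subseteq> {..<?N}" using \<phi>(1) by auto
  ultimately have bij: "bij_betw \<phi> {..<?N} {..<?N}"
    by (simp add: bij_betw_def endo_inj_surj)
  have "{i, j} \<in> edges (blowup g G) \<longleftrightarrow> {\<phi> i, \<phi> j} \<in> edges (blowup g G')" if "i < ?N" "j < ?N" for i j
    using that coord_less[OF that(1)] coord_less[OF that(2)]
    by (simp add: blowup_edge[OF g refl] blowup_edge[OF g n[symmetric]] \<phi> adj_def cell_def \<sigma>_eq e')
  then show ?thesis
    unfolding isomorphic_def verts_blowup n using bij by (intro exI[of _ \<phi>]) auto
qed

lemma blowup_isoE:
  assumes g: "sym_rule g" and n: "n = card (verts G)" and iso: "blowup g G \<simeq> blowup g G'"
  obtains \<phi> where "card (verts G') = n" "bij_betw \<phi> {..<n * (n * 5)} {..<n * (n * 5)}"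
    "\<And>i j. i < n * (n * 5) \<Longrightarrow> j < n * (n * 5) \<Longrightarrow>
      adj g n (edge_rel G') (\<phi> i) (\<phi> j) = adj g n (edge_rel G) i j"
proof -
  let ?n' = "card (verts G')"
  from iso obtain \<phi> where bij: "bij_betw \<phi> {..<n * (n * 5)} {..<?n' * (?n' * 5)}"
    and e: "\<forall>i\<in>{..<n * (n * 5)}. \<forall>j\<in>{..<n * (n * 5)}.
       {i, j} \<in> edges (blowup g G) \<longleftrightarrow> {\<phi> i, \<phi> j} \<in> edges (blowup g G')"
    unfolding isomorphic_def verts_blowup n by blast
  have "n\<^sup>2 = ?n'\<^sup>2" using bij_betw_same_card[OF bij] by (simp add: power2_eq_square)
  then have n': "?n' = n" by simp
  have "\<phi> i < n * (n * 5)" if "i < n * (n * 5)" for i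
    using bij_betwE[OF bij] that n' by auto
  then have "adj g n (edge_rel G') (\<phi> i) (\<phi> j) = adj g n (edge_rel G) i j"
    if "i < n * (n * 5)" "j < n * (n * 5)" for i j
    using e that blowup_edge[OF g n] blowup_edge[OF g n'[symmetric]] by simp
  then show ?thesis using that n' bij by simp
qed

text \<open>Once copies go to copies and blocks to blocks, following one copy per vertex yields the
  isomorphism.\<close>

lemma recover_iso:
  assumes verts: "verts G = {..<n}" "verts G' = {..<n}"
    and bij: "bij_betw \<phi> {..<n * (n * 5)} {..<n * (n * 5)}"
    and V: "\<And>i. i < n * (n * 5) \<Longrightarrow> part (\<phi> i) = 0 \<longleftrightarrow> part i = 0"
    and same: "\<And>i j. i < n * (n * 5) \<Longrightarrow> j < n * (n * 5) \<Longrightarrow> part i = 0 \<Longrightarrow> part j = 0 \<Longrightarrow>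
      vu n (\<phi> i) = vu n (\<phi> j) \<longleftrightarrow> vu n i = vu n j"
    and edge: "\<And>i j. i < n * (n * 5) \<Longrightarrow> j < n * (n * 5) \<Longrightarrow> part i = 0 \<Longrightarrow> part j = 0 \<Longrightarrow>
      edge_rel G' (vu n (\<phi> i)) (vu n (\<phi> j)) = edge_rel G (vu n i) (vu n j)"
  shows "G \<simeq> G'"
proof -
  define \<sigma> where "\<sigma> u = vu n (\<phi> (idx n 0 u 0))" for u
  have i: "idx n 0 u 0 < n * (n * 5)" "part (idx n 0 u 0) = 0" "vu n (idx n 0 u 0) = u" if "u < n" for u
    using that by (simp_all add: idx_less idx_simps)
  have \<phi>_less: "\<phi> i < n * (n * 5)" if "i < n * (n * 5)" for i
    using bij_betwE[OF bij] that by auto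
  have "inj_on \<sigma> {..<n}"
    by (rule inj_onI) (use same i in \<open>auto simp: \<sigma>_def\<close>)
  moreover have "\<sigma> ` {..<n} \<subseteq> {..<n}"
    using coord_less(1)[OF \<phi>_less] i(1) by (auto simp: \<sigma>_def)
  ultimately have "bij_betw \<sigma> {..<n} {..<n}"
    by (simp add: bij_betw_def endo_inj_surj)
  moreover have "{u, v} \<in> edges G \<longleftrightarrow> {\<sigma> u, \<sigma> v} \<in> edges G'" if "u < n" "v < n" for u v
    using edge[OF i(1)[OF that(1)] i(1)[OF that(2)] i(2)[OF that(1)] i(2)[OF that(2)]] i(3) that
    by (simp add: edge_rel_def \<sigma>_def)
  ultimately show ?thesis
    unfolding isomorphic_def verts by (intro exI[of _ \<sigma>]) auto
qed

text \<open>The degree argument assumes \<open>2 \<le> n\<close>; the remaining graphs have at most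
  one vertex and no edge.\<close>

lemma trivial_iso:
  fixes G G' :: "nat ugraph"
  assumes "simple_graph G" "simple_graph G'" "verts G = {..<n}" "verts G' = {..<n}" "n < 2"
  shows "G \<simeq> G'"
proof -
  have no_edge: "edges H = {}" if H: "simple_graph H" "verts H = {..<n}" for H :: "nat ugraph"
  proof (rule ccontr)
    assume "edges H \<noteq> {}"
    then obtain e where "e \<subseteq> {..<n}" "card e = 2" using H by (auto simp: simple_graph_def)
    then have "2 \<le> card {..<n}" by (metis card_mono finite_lessThan)
    then show False using assms(5) by simp
  qed
  have "bij_betw id (verts G) (verts G')" using assms(3,4) by simp
  then show ?thesis
    unfolding isomorphic_def using no_edge assms(1-4) by blast
qed

text \<open>This and its universal counterpart carry first-order definitions along an isomorphism,
  one quantifier at a time.\<close>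

lemma bij_betw_Bex_cong:
  assumes "bij_betw f A A" "\<And>x. x \<in> A \<Longrightarrow> Q (f x) = P x"
  shows "(\<exists>y\<in>A. Q y) \<longleftrightarrow> (\<exists>x\<in>A. P x)"
  using assms unfolding bij_betw_def by (metis image_iff)

lemma bij_betw_Ball_cong:
  assumes "bij_betw f A A" "\<And>x. x \<in> A \<Longrightarrow> Q (f x) = P x"
  shows "(\<forall>y\<in>A. Q y) \<longleftrightarrow> (\<forall>x\<in>A. P x)"
  using assms unfolding bij_betw_def by (metis image_iff)

section \<open>Degrees recognise the copies of vertices\<close>

definition nbr_count :: "nat \<Rightarrow> (nat \<Rightarrow> nat \<Rightarrow> bool) \<Rightarrow> nat \<Rightarrow> nat" where
  "nbr_count N R i = card {j \<in> {..<N}. R i j}"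

lemma nbr_count_transfer:
  assumes "bij_betw \<phi> {..<N} {..<N}" "\<And>j. j < N \<Longrightarrow> R' (\<phi> i) (\<phi> j) = R i j"
  shows "nbr_count N R' (\<phi> i) = nbr_count N R i"
proof -
  have "{j \<in> \<phi> ` {..<N}. R' (\<phi> i) j} = \<phi> ` {j \<in> {..<N}. R i j}"
    using assms(2) by auto
  then have "{j \<in> {..<N}. R' (\<phi> i) j} = \<phi> ` {j \<in> {..<N}. R i j}"
    by (simp only: bij_betw_imp_surj_on[OF assms(1)])
  moreover have "inj_on \<phi> {j \<in> {..<N}. R i j}"
    using assms(1) by (rule inj_on_subset[OF bij_betw_imp_inj_on]) auto
  ultimately show ?thesis by (simp add: nbr_count_def card_image)
qed

lemma nbr_count_coords:
  assumes "\<And>j. R i j \<longleftrightarrow> Q (j mod 5) (vu n j) (vw n j)"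
  shows "nbr_count (n * (n * 5)) R i = card {(t, u, w). t < 5 \<and> u < n \<and> w < n \<and> Q t u w}"
  unfolding nbr_count_def assms by (rule card_coords)

lemma finite_coords: "finite {(t, u, w). t < (5::nat) \<and> u < n \<and> w < n \<and> Q t u w}" for n :: nat
  by (rule finite_subset[of _ "{..<5} \<times> {..<n} \<times> {..<n}"]) auto

text \<open>Non-neighbours, the vertex itself included: a copy of \<open>u\<close> misses its own
  part and the \<open>2 * n\<close> pairs starting with \<open>u\<close>. A pair misses its part,
  \<open>3 * n\<close> copies and at most one reversal, which is less for
  \<open>2 \<le> n\<close>.\<close>

lemma co_nbr_count:
  assumes i: "i < n * (n * 5)" and n: "2 \<le> n"
  shows "part i = 0 \<longleftrightarrow> nbr_count (n * (n * 5)) (\<lambda>i j. \<not> adj co_rule n a i j) i = 3 * (n * n) + 2 * n"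
proof -
  let ?u = "vu n i" and ?w = "vw n i" and ?t = "i mod 5"
  let ?S = "{(t, u, w). t < 5 \<and> u < n \<and> w < n \<and> \<not> cell co_rule (a ?u ?w) ?u ?w ?t u w t}"
  have uw: "?u < n" "?w < n" using coord_less[OF i] by auto
  have deg: "nbr_count (n * (n * 5)) (\<lambda>i j. \<not> adj co_rule n a i j) i = card ?S"
    by (rule nbr_count_coords) (simp add: adj_def)
  show ?thesis
  proof (cases "part i = 0")
    case True
    then have t: "?t - 2 = 0" by (simp add: part_def)
    have "?S = {..<3} \<times> {..<n} \<times> {..<n} \<union> {3, 4} \<times> {?u} \<times> {..<n}"
      using uw by (auto simp: cell_def co_rule_def t)
    also have "card \<dots> = card ({..<3 :: nat} \<times> {..<n} \<times> {..<n}) + card ({3, 4 :: nat} \<times> {?u} \<times> {..<n})"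
      by (rule card_Un_disjoint) auto
    also have "\<dots> = 3 * (n * n) + 2 * n" by (simp add: card_cartesian_product)
    finally show ?thesis using True deg by simp
  next
    case False
    then have t: "?t = 3 \<or> ?t = 4" by (auto simp: part_def)
    \<comment> \<open>\<open>7 - ?t\<close> exchanges the residues 3 and 4 of the two pair
      parts.\<close>
    have "?S \<subseteq> {?t} \<times> {..<n} \<times> {..<n} \<union> ({..<3} \<times> {?u} \<times> {..<n} \<union> {(7 - ?t, ?w, ?u)})" (is "_ \<subseteq> ?X \<union> (?Y \<union> ?Z)")
      using t by (auto simp: cell_def co_rule_def split: if_splits)
    then have "card ?S \<le> card (?X \<union> (?Y \<union> ?Z))" by (intro card_mono) auto
    also have "\<dots> \<le> card ?X + (card ?Y + card ?Z)"
      by (intro order.trans[OF card_Un_le] add_left_mono card_Un_le)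
    also have "\<dots> = n * n + 3 * n + 1" by (simp add: card_cartesian_product)
    also have "\<dots> < 3 * (n * n) + 2 * n"
    proof -
      have "2 * n \<le> n * n" using n by (rule mult_le_mono1)
      then show ?thesis using n by linarith
    qed
    finally show ?thesis using False deg by simp
  qed
qed

text \<open>A copy sees \<open>n\<close> pairs of part 1 and all of part 2. Pairs see strictly more:
  in part 1 at least \<open>3 * n + n * n - 2\<close> vertices, in part 2 all
  \<open>3 * (n * n)\<close> copies.\<close>

lemma star_nbr_count:
  assumes i: "i < n * (n * 5)" and n: "2 \<le> n"
  shows "part i = 0 \<longleftrightarrow> nbr_count (n * (n * 5)) (adj star_rule n a) i = n + n * n"
proof -
  let ?u = "vu n i" and ?w = "vw n i" and ?t = "i mod 5"
  let ?S = "{(t, u, w). t < 5 \<and> u < n \<and> w < n \<and> cell star_rule (a ?u ?w) ?u ?w ?t u w t}"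
  have uw: "?u < n" "?w < n" using coord_less[OF i] by auto
  have deg: "nbr_count (n * (n * 5)) (adj star_rule n a) i = card ?S"
    by (rule nbr_count_coords) (simp add: adj_def)
  have nn: "2 * n \<le> n * n" using n by (rule mult_le_mono1)
  show ?thesis
  proof (cases "part i = 0")
    case True
    then have t: "?t - 2 = 0" by (simp add: part_def)
    have "?S = {3} \<times> {?u} \<times> {..<n} \<union> {4 :: nat} \<times> {..<n} \<times> {..<n}"
      using uw by (auto simp: cell_def star_rule_def t)
    also have "card \<dots> = card ({3 :: nat} \<times> {?u} \<times> {..<n}) + card ({4 :: nat} \<times> {..<n} \<times> {..<n})"
      by (rule card_Un_disjoint) auto
    also have "\<dots> = n + n * n" by (simp add: card_cartesian_product)
    finally show ?thesis using True deg by simp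
  next
    case False
    then consider "?t = 3" | "?t = 4" by (force simp: part_def)
    then have "n + n * n < card ?S"
    proof cases
      case 1
      let ?X = "{..<3 :: nat} \<times> {?u} \<times> {..<n}" and ?Y = "{4 :: nat} \<times> ({..<n} \<times> {..<n} - {(?u, ?w), (?w, ?u)})"
      have "card ({..<n} \<times> {..<n}) - card {(?u, ?w), (?w, ?u)} \<le> card ({..<n} \<times> {..<n} - {(?u, ?w), (?w, ?u)})"
        by (rule diff_card_le_card_Diff) simp
      moreover have "card {(?u, ?w), (?w, ?u)} \<le> 2"
        using card_length[of "[(?u, ?w), (?w, ?u)]"] by simp
      ultimately have "n * n - 2 \<le> card ({..<n} \<times> {..<n} - {(?u, ?w), (?w, ?u)})"
        by (simp add: card_cartesian_product)
      then have "n + n * n < card ?X + card ?Y"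
        using n nn by (simp add: card_cartesian_product)
      also have "\<dots> = card (?X \<union> ?Y)"
        by (rule card_Un_disjoint[symmetric]) auto
      also have "\<dots> \<le> card ?S"
        using uw by (intro card_mono finite_coords) (auto simp: cell_def star_rule_def 1)
      finally show ?thesis .
    next
      case 2
      have "n + n * n < 3 * (n * n)" using n nn by linarith
      also have "\<dots> = card ({..<3 :: nat} \<times> {..<n} \<times> {..<n})" by (simp add: card_cartesian_product)
      also have "\<dots> \<le> card ?S"
        by (intro card_mono finite_coords) (auto simp: cell_def star_rule_def 2)
      finally show ?thesis .
    qed
    then show ?thesis using False deg by simp
  qed
qed


section \<open>Defining the original graph inside its blow-up\<close>

lemma vertexE:
  assumes "t < 5" "u < n" "w < n"
  obtains x where "x < n * (n * 5)" "x mod 5 = t" "part x = t - 2" "vu n x = u" "vw n x = w"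
  using that[of "idx n t u w"] assms by (simp add: idx_less idx_simps)

text \<open>For \<open>2 \<le> n\<close> every residue has three vertices with coordinates in
  \<open>{0, 1}\<close>, and one of them avoids \<open>x\<close> and \<open>y\<close>.\<close>

lemma third_vertex:
  fixes n t x y :: nat
  assumes "t < 5" "2 \<le> n"
  obtains z where "z < n * (n * 5)" "z mod 5 = t" "z \<noteq> x" "z \<noteq> y"
proof -
  have z: "idx n t u w < n * (n * 5)" "idx n t u w mod 5 = t" "vu n (idx n t u w) = u" "vw n (idx n t u w) = w"
    if "u \<le> 1" "w \<le> 1" for u w
    using that assms by (simp_all add: idx_less idx_simps)
  have "idx n t 0 0 \<noteq> idx n t 0 1" "idx n t 0 0 \<noteq> idx n t 1 0" "idx n t 0 1 \<noteq> idx n t 1 0"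
    using z(3,4)[of 0 0] z(3,4)[of 0 1] z(3,4)[of 1 0] by (metis le_refl zero_le_one zero_neq_one)+
  then consider "idx n t 0 0 \<notin> {x, y}" | "idx n t 0 1 \<notin> {x, y}" | "idx n t 1 0 \<notin> {x, y}"
    by fastforce
  then show thesis
    by cases (use z(1,2) that[of "idx n t 0 0"] that[of "idx n t 0 1"] that[of "idx n t 1 0"] in simp_all)
qed

context
  fixes n :: nat and a :: "nat \<Rightarrow> nat \<Rightarrow> bool"
  assumes n: "2 \<le> n" and sym: "\<And>u w. a u w = a w u" and irrefl: "\<And>u. \<not> a u u"
begin

lemma co_attached_iff:
  "part i = 0 \<Longrightarrow> part x \<noteq> 0 \<Longrightarrow> \<not> adj co_rule n a i x \<longleftrightarrow> vu n i = vu n x"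
  by (auto simp: adj_co)

text \<open>The right-hand side mentions only adjacency and membership in part 0, both of which an
  isomorphism of blow-ups preserves.\<close>

lemma co_block_iff:
  assumes "i < n * (n * 5)" "j < n * (n * 5)" "part i = 0" "part j = 0"
  shows "vu n i = vu n j \<longleftrightarrow> (\<exists>x\<in>{..<n * (n * 5)}. part x \<noteq> 0 \<and> \<not> adj co_rule n a i x \<and> \<not> adj co_rule n a j x)"
proof
  assume "vu n i = vu n j"
  then show "\<exists>x\<in>{..<n * (n * 5)}. part x \<noteq> 0 \<and> \<not> adj co_rule n a i x \<and> \<not> adj co_rule n a j x"
    using coord_less[OF assms(1)] assms(3,4)
    by (intro bexI[of _ "idx n 3 (vu n i) (vw n i)"]) (simp_all add: idx_less idx_simps adj_co)
qed (use assms co_attached_iff in auto)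

text \<open>An isomorphism may swap parts 1 and 2, so the formula must not name them. That no third
  pair is non-adjacent to both \<open>x\<close> and \<open>y\<close> expresses that they lie in
  different parts, where non-adjacency means being the two orientations of an edge.\<close>

lemma co_edge_iff:
  assumes "i < n * (n * 5)" "j < n * (n * 5)" "part i = 0" "part j = 0"
  shows "a (vu n i) (vu n j) \<longleftrightarrow> (\<exists>x\<in>{..<n * (n * 5)}. \<exists>y\<in>{..<n * (n * 5)}.
     part x \<noteq> 0 \<and> part y \<noteq> 0 \<and> x \<noteq> y \<and>
     \<not> adj co_rule n a i x \<and> \<not> adj co_rule n a j y \<and> \<not> adj co_rule n a x y \<and>
     (\<forall>z\<in>{..<n * (n * 5)}. part z \<noteq> 0 \<longrightarrow> \<not> adj co_rule n a x z \<longrightarrow> \<not> adj co_rule n a y z \<longrightarrow> z = x \<or> z = y))"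
    (is "_ \<longleftrightarrow> ?rhs")
proof
  let ?u = "vu n i" and ?v = "vu n j"
  assume e: "a ?u ?v"
  note uv = coord_less(1)[OF assms(1)] coord_less(1)[OF assms(2)]
  obtain x where x: "x < n * (n * 5)" "x mod 5 = 3" "part x = 3 - 2" "vu n x = ?u" "vw n x = ?v"
    by (rule vertexE[OF _ uv, of 3]) simp
  obtain y where y: "y < n * (n * 5)" "y mod 5 = 4" "part y = 4 - 2" "vu n y = ?v" "vw n y = ?u"
    by (rule vertexE[OF _ uv(2,1), of 4]) simp
  have third: "z = x \<or> z = y"
    if z: "part z \<noteq> 0" "\<not> adj co_rule n a x z" "\<not> adj co_rule n a y z" for z
  proof -
    have "z mod 5 = 3 \<or> z mod 5 = 4" using z(1) by (auto simp: part_def)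
    then show ?thesis
    proof
      assume m: "z mod 5 = 3"
      then have "part z = 1" by (simp add: part_def)
      then have "vu n z = ?u" "vw n z = ?v" using z(3) y by (simp_all add: adj_co)
      then have "z = x" using m x by (intro vertex_eqI[of z x n]) simp_all
      then show ?thesis ..
    next
      assume m: "z mod 5 = 4"
      then have "part z = 2" by (simp add: part_def)
      then have "vu n z = ?v" "vw n z = ?u" using z(2) x by (simp_all add: adj_co)
      then have "z = y" using m y by (intro vertex_eqI[of z y n]) simp_all
      then show ?thesis ..
    qed
  qed
  show ?rhs
  proof (intro bexI conjI ballI impI)
    show "\<not> adj co_rule n a x y" using x y e by (simp add: adj_co)
    show "x \<noteq> y" using x y by auto
  qed (use x y third assms(3,4) in \<open>simp_all add: adj_co\<close>)
next
  assume ?rhs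
  then obtain x y where xy: "x < n * (n * 5)" "y < n * (n * 5)" "part x \<noteq> 0" "part y \<noteq> 0"
    "\<not> adj co_rule n a i x" "\<not> adj co_rule n a j y" "\<not> adj co_rule n a x y"
    and z: "\<And>z. z < n * (n * 5) \<Longrightarrow> part z \<noteq> 0 \<Longrightarrow> \<not> adj co_rule n a x z \<Longrightarrow> \<not> adj co_rule n a y z \<Longrightarrow> z = x \<or> z = y"
    by auto
  \<comment> \<open>Within one part all vertices are mutually non-adjacent, so any third vertex of
    the part violates the last condition.\<close>
  have "part x \<noteq> part y"
  proof
    assume eq: "part x = part y"
    have "x mod 5 < 5" by simp
    then obtain z where "z < n * (n * 5)" "z mod 5 = x mod 5" "z \<noteq> x" "z \<noteq> y"
      using third_vertex[OF _ n] by metis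
    moreover from this have "part z = part x" by (simp add: part_def)
    ultimately show False using z[of z] xy(3) eq by (simp add: adj_co)
  qed
  then show "a (vu n i) (vu n j)"
    using xy(3-7) assms(3,4) by (auto simp: adj_co)
qed

text \<open>Unlike for \<open>co_rule\<close>, the pair parts are distinguishable: part 2 is joined
  to every copy, part 1 only to the block of its first coordinate, and \<open>2 \<le> n\<close>
  provides another block.\<close>

lemma star_part1_iff:
  assumes "x < n * (n * 5)" "part x \<noteq> 0"
  shows "(\<exists>k\<in>{..<n * (n * 5)}. part k = 0 \<and> \<not> adj star_rule n a k x) \<longleftrightarrow> part x = 1"
proof
  assume "\<exists>k\<in>{..<n * (n * 5)}. part k = 0 \<and> \<not> adj star_rule n a k x"
  then show "part x = 1" using part_cases[of x] assms(2) by (auto simp: adj_star)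
next
  assume x: "part x = 1"
  obtain u where "u < n" "u \<noteq> vu n x" using n by (metis One_nat_def Suc_1 Suc_le_lessD less_le_trans zero_less_Suc zero_neq_one lessI)
  then show "\<exists>k\<in>{..<n * (n * 5)}. part k = 0 \<and> \<not> adj star_rule n a k x"
    using x by (intro bexI[of _ "idx n 0 u 0"]) (simp_all add: idx_less idx_simps adj_star)
qed

lemma star_block_iff:
  assumes "i < n * (n * 5)" "j < n * (n * 5)" "part i = 0" "part j = 0"
  shows "vu n i = vu n j \<longleftrightarrow> (\<exists>x\<in>{..<n * (n * 5)}. part x = 1 \<and> adj star_rule n a i x \<and> adj star_rule n a j x)"
proof
  assume "vu n i = vu n j"
  then show "\<exists>x\<in>{..<n * (n * 5)}. part x = 1 \<and> adj star_rule n a i x \<and> adj star_rule n a j x"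
    using coord_less[OF assms(1)] assms(3,4)
    by (intro bexI[of _ "idx n 3 (vu n i) (vw n i)"]) (simp_all add: idx_less idx_simps adj_star)
qed (use assms in \<open>auto simp: adj_star\<close>)

text \<open>A vertex \<open>z\<close> of part 2 misses in part 1 its twin and, for an edge, the
  reversal. Two missed vertices from different blocks thus witness an edge; without distinct blocks,
  \<open>x = y\<close> equal to the twin would pass.\<close>

lemma star_edge_iff':
  assumes "i < n * (n * 5)" "j < n * (n * 5)" "part i = 0" "part j = 0"
  shows "a (vu n i) (vu n j) \<longleftrightarrow> vu n i \<noteq> vu n j \<and> (\<exists>x\<in>{..<n * (n * 5)}. \<exists>y\<in>{..<n * (n * 5)}. \<exists>z\<in>{..<n * (n * 5)}.
     part x = 1 \<and> part y = 1 \<and> part z = 2 \<and> adj star_rule n a i x \<and> adj star_rule n a j y \<and>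
     \<not> adj star_rule n a x z \<and> \<not> adj star_rule n a y z)"
    (is "_ \<longleftrightarrow> _ \<and> ?rhs")
proof
  let ?u = "vu n i" and ?v = "vu n j"
  assume e: "a ?u ?v"
  note uv = coord_less(1)[OF assms(1)] coord_less(1)[OF assms(2)]
  obtain x where x: "x < n * (n * 5)" "x mod 5 = 3" "part x = 3 - 2" "vu n x = ?u" "vw n x = ?v"
    by (rule vertexE[OF _ uv, of 3]) simp
  obtain y where y: "y < n * (n * 5)" "y mod 5 = 3" "part y = 3 - 2" "vu n y = ?v" "vw n y = ?u"
    by (rule vertexE[OF _ uv(2,1), of 3]) simp
  obtain z where z: "z < n * (n * 5)" "z mod 5 = 4" "part z = 4 - 2" "vu n z = ?u" "vw n z = ?v"
    by (rule vertexE[OF _ uv, of 4]) simp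
  have "?u \<noteq> ?v" using e irrefl by metis
  moreover have "a ?v ?u" using e sym by simp
  ultimately have "\<not> adj star_rule n a y z" "\<not> adj star_rule n a x z" "adj star_rule n a i x" "adj star_rule n a j y"
    using x y z assms(3,4) by (simp_all add: adj_star)
  then have ?rhs using x y z by (intro bexI[of _ x] bexI[of _ y] bexI[of _ z] conjI) simp_all
  with \<open>?u \<noteq> ?v\<close> show "?u \<noteq> ?v \<and> ?rhs" ..
next
  assume "vu n i \<noteq> vu n j \<and> ?rhs"
  then obtain x y z where ne: "vu n i \<noteq> vu n j" and xyz: "part x = 1" "part y = 1" "part z = 2"
    "adj star_rule n a i x" "adj star_rule n a j y" "\<not> adj star_rule n a x z" "\<not> adj star_rule n a y z"
    by blast
  have "vu n x = vu n i" "vu n y = vu n j" using xyz assms(3,4) by (auto simp: adj_star)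
  then show "a (vu n i) (vu n j)"
    using star_nonadj[OF xyz(6)] star_nonadj[OF xyz(7)] xyz(1-3) ne sym by auto
qed

end

lemma co_reflects_iso:
  assumes simple: "simple_graph G" "simple_graph G'"
    and verts: "verts G = {..<card (verts G)}" "verts G' = {..<card (verts G')}"
    and iso: "blowup co_rule G \<simeq> blowup co_rule G'"
  shows "G \<simeq> G'"
proof -
  define n where "n = card (verts G)"
  let ?D = "{..<n * (n * 5)}"
  obtain \<phi> where n': "card (verts G') = n" and bij: "bij_betw \<phi> ?D ?D"
    and adj: "\<And>i j. i < n * (n * 5) \<Longrightarrow> j < n * (n * 5) \<Longrightarrow>
      adj co_rule n (edge_rel G') (\<phi> i) (\<phi> j) = adj co_rule n (edge_rel G) i j"
    using blowup_isoE[OF sym_co n_def iso] by metis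
  have V: "verts G = {..<n}" "verts G' = {..<n}" using verts n' n_def by simp_all
  show ?thesis
  proof (cases "n < 2")
    case True
    then show ?thesis using trivial_iso simple V by blast
  next
    case False
    then have n: "2 \<le> n" by simp
    note r = n edge_rel_sym edge_rel_irrefl[OF simple(1)]
    note r' = n edge_rel_sym edge_rel_irrefl[OF simple(2)]
    have \<phi>: "\<phi> i < n * (n * 5)" if "i < n * (n * 5)" for i
      using bij_betwE[OF bij] that by auto
    have eq: "\<phi> i = \<phi> j \<longleftrightarrow> i = j" if "i < n * (n * 5)" "j < n * (n * 5)" for i j
      using bij that by (auto simp: bij_betw_def inj_on_def)
    \<comment> \<open>Part 0 is characterised by the number of non-neighbours, which the bijection
      preserves.\<close>
    have part: "part (\<phi> i) = 0 \<longleftrightarrow> part i = 0" if "i < n * (n * 5)" for i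
      unfolding co_nbr_count[OF that n, of "edge_rel G"] co_nbr_count[OF \<phi>[OF that] n, of "edge_rel G'"]
      using nbr_count_transfer[OF bij, of "\<lambda>i j. \<not> adj co_rule n (edge_rel G') i j" i
          "\<lambda>i j. \<not> adj co_rule n (edge_rel G) i j"] adj that by simp
    show ?thesis
    proof (rule recover_iso[OF V bij part])
      fix i j assume ij: "i < n * (n * 5)" "j < n * (n * 5)" "part i = 0" "part j = 0"
      then have ij': "\<phi> i < n * (n * 5)" "\<phi> j < n * (n * 5)" "part (\<phi> i) = 0" "part (\<phi> j) = 0"
        using \<phi> part by auto
      show "vu n (\<phi> i) = vu n (\<phi> j) \<longleftrightarrow> vu n i = vu n j"
        unfolding co_block_iff[where a = "edge_rel G", OF r ij] co_block_iff[where a = "edge_rel G'", OF r' ij']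
        by (rule bij_betw_Bex_cong[OF bij]) (simp add: adj part ij(1,2))
      show "edge_rel G' (vu n (\<phi> i)) (vu n (\<phi> j)) = edge_rel G (vu n i) (vu n j)"
        unfolding co_edge_iff[where a = "edge_rel G", OF r ij] co_edge_iff[where a = "edge_rel G'", OF r' ij']
        by (intro bij_betw_Bex_cong[OF bij] arg_cong2[where f = conj] bij_betw_Ball_cong[OF bij])
          (simp_all add: adj part ij(1,2) eq)
    qed
  qed
qed

lemma star_reflects_iso:
  assumes simple: "simple_graph G" "simple_graph G'"
    and verts: "verts G = {..<card (verts G)}" "verts G' = {..<card (verts G')}"
    and iso: "blowup star_rule G \<simeq> blowup star_rule G'"
  shows "G \<simeq> G'"
proof -
  define n where "n = card (verts G)"
  let ?D = "{..<n * (n * 5)}"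
  obtain \<phi> where n': "card (verts G') = n" and bij: "bij_betw \<phi> ?D ?D"
    and adj: "\<And>i j. i < n * (n * 5) \<Longrightarrow> j < n * (n * 5) \<Longrightarrow>
      adj star_rule n (edge_rel G') (\<phi> i) (\<phi> j) = adj star_rule n (edge_rel G) i j"
    using blowup_isoE[OF sym_star n_def iso] by metis
  have V: "verts G = {..<n}" "verts G' = {..<n}" using verts n' n_def by simp_all
  show ?thesis
  proof (cases "n < 2")
    case True
    then show ?thesis using trivial_iso simple V by blast
  next
    case False
    then have n: "2 \<le> n" by simp
    note r = n edge_rel_sym edge_rel_irrefl[OF simple(1)]
    note r' = n edge_rel_sym edge_rel_irrefl[OF simple(2)]
    have \<phi>: "\<phi> i < n * (n * 5)" if "i < n * (n * 5)" for i
      using bij_betwE[OF bij] that by auto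
    have part: "part (\<phi> i) = 0 \<longleftrightarrow> part i = 0" if "i < n * (n * 5)" for i
      unfolding star_nbr_count[OF that n, of "edge_rel G"] star_nbr_count[OF \<phi>[OF that] n, of "edge_rel G'"]
      using nbr_count_transfer[OF bij, of "adj star_rule n (edge_rel G')" i
          "adj star_rule n (edge_rel G)"] adj that by simp
    \<comment> \<open>Part 0 being preserved, its joins to the pairs tell parts 1 and 2 apart on
      both sides.\<close>
    have part1: "part (\<phi> x) = 1 \<longleftrightarrow> part x = 1" if x: "x < n * (n * 5)" for x
    proof (cases "part x = 0")
      case False
      have "part (\<phi> x) = 1 \<longleftrightarrow> (\<exists>k\<in>?D. part k = 0 \<and> \<not> adj star_rule n (edge_rel G') k (\<phi> x))"
        using star_part1_iff[where a = "edge_rel G'", OF r' \<phi>[OF x]] part[OF x] False by simp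
      also have "\<dots> \<longleftrightarrow> (\<exists>k\<in>?D. part k = 0 \<and> \<not> adj star_rule n (edge_rel G) k x)"
        by (rule bij_betw_Bex_cong[OF bij]) (simp add: adj part x)
      also have "\<dots> \<longleftrightarrow> part x = 1" using star_part1_iff[where a = "edge_rel G", OF r x] False by simp
      finally show ?thesis .
    qed (use part[OF x] in simp)
    have part2: "part (\<phi> x) = 2 \<longleftrightarrow> part x = 2" if x: "x < n * (n * 5)" for x
      using part_cases[of x] part_cases[of "\<phi> x"] part1[OF x] part[OF x] by auto
    show ?thesis
    proof (rule recover_iso[OF V bij part])
      fix i j assume ij: "i < n * (n * 5)" "j < n * (n * 5)" "part i = 0" "part j = 0"
      then have ij': "\<phi> i < n * (n * 5)" "\<phi> j < n * (n * 5)" "part (\<phi> i) = 0" "part (\<phi> j) = 0"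
        using \<phi> part by auto
      show same: "vu n (\<phi> i) = vu n (\<phi> j) \<longleftrightarrow> vu n i = vu n j"
        unfolding star_block_iff[where a = "edge_rel G", OF r ij] star_block_iff[where a = "edge_rel G'", OF r' ij']
        by (rule bij_betw_Bex_cong[OF bij]) (simp add: adj part1[simplified] ij(1,2))
      show "edge_rel G' (vu n (\<phi> i)) (vu n (\<phi> j)) = edge_rel G (vu n i) (vu n j)"
        unfolding star_edge_iff'[where a = "edge_rel G", OF r ij] star_edge_iff'[where a = "edge_rel G'", OF r' ij'] same
        by (intro arg_cong2[where f = conj] refl bij_betw_Bex_cong[OF bij])
          (simp_all add: adj part1[simplified] part2 ij(1,2))
    qed
  qed
qed

lemma co_rule_iso_complete:
  assumes "\<And>G H. simple_graph G \<Longrightarrow> H \<in> \<H> \<Longrightarrow> \<not> contains_induced (blowup co_rule G) H"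
  shows "isomorphism_complete (Free \<H>)"
proof (rule isomorphism_complete_blowup[OF sym_co])
  show "blowup co_rule G \<simeq> blowup co_rule G' \<longleftrightarrow> G \<simeq> G'"
    if "(G, G') \<in> GI_instances {G. simple_graph G}" for G G'
    using that blowup_iso[OF sym_co] co_reflects_iso unfolding GI_instances_def by blast
qed (use assms simple_blowup[OF sym_co] in \<open>auto simp: Free_def\<close>)

lemma star_rule_iso_complete:
  assumes "\<And>G H. simple_graph G \<Longrightarrow> H \<in> \<H> \<Longrightarrow> \<not> contains_induced (blowup star_rule G) H"
  shows "isomorphism_complete (Free \<H>)"
proof (rule isomorphism_complete_blowup[OF sym_star])
  show "blowup star_rule G \<simeq> blowup star_rule G' \<longleftrightarrow> G \<simeq> G'"
    if "(G, G') \<in> GI_instances {G. simple_graph G}" for G G'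
    using that blowup_iso[OF sym_star] star_reflects_iso unfolding GI_instances_def by blast
qed (use assms simple_blowup[OF sym_star] in \<open>auto simp: Free_def\<close>)

theorem theorem4:
  "isomorphism_complete
     (Free {copies 2 (complete_graph 2) \<uplus> complete_graph 1, complete_graph 4}) \<and>
   isomorphism_complete
     (Free {path_graph 6, path_graph 4 \<uplus> path_graph 2, complete_graph 4}) \<and>
   isomorphism_complete
     (Free {star_forest [1, 0, 3, 0], complete_graph 4})"
  using co_free_2K2_K1 co_free_P6 co_free_P4_P2 star_free
    blowup_K4_free[of co_rule, OF _ sym_co] blowup_K4_free[of star_rule, OF _ sym_star]
  by (intro conjI co_rule_iso_complete star_rule_iso_complete) auto

end
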